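(* For any $\omega>0$, any $h\in\left(-\frac{1}{2\omega^2},0\right)$ and any $\beta>0$, the spatial anisotropic Kepler problem with Hamiltonian $$H(r,\theta,z,p_r,p_\theta,p_z)=\frac12\left(p_r^2+\frac{p_\theta^2}{r^2}+p_z^2\right)-\frac{1}{\sqrt{r^2+(1+\beta)z^2}}$$ admits a non-planar (quasi-)periodic solution with energy $h$ and angular momentum $\omega$.
   Context: Here $(r,\theta,z)$ with $r>0$ are cylindrical coordinates and $(p_r,p_\theta,p_z)$ their conjugate momenta. The angular momentum is the conserved quantity $p_\theta$, and the energy is the value of $H$. Fixing $p_\theta=\omega$, the system reduces to the system in $(r,z)$ with Hamiltonian $\frac12(p_r^2+p_z^2)+V(r,z)$, where $V(r,z)=\frac{\omega^2}{2r^2}-\frac{1}{\sqrt{r^2+(1+\beta)z^2}}$. A (quasi-)periodic solution means a solution whose $(r,z)$-component is a periodic solution of this reduced system, with some period $T$; with $\Delta\theta=\int_0^T\omega/r(t)^2\,dt$, the solution of the full system is periodic if $\Delta\theta/(2\pi)$ is rational and quasi-periodic if it is irrational. A solution is planar if $z\equiv0$, and non-planar otherwise. *)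

theory Defs
  imports "HOL-Analysis.Analysis"
begin

text \<open>Hamilton's equations, solved for all times. For a basis vector \<open>b\<close>, the derivative at \<open>s = 0\<close>
  of \<open>H\<close> along \<open>s *\<^sub>R b\<close> is the partial derivative of \<open>H\<close> in the coordinate selected by \<open>b\<close>.
  As \<open>deriv\<close> is total, the notion is only used where \<open>H\<close> is differentiable (below, for \<open>r > 0\<close>).\<close>

definition hamilton_solution ::
  "('a::euclidean_space \<times> 'a \<Rightarrow> real) \<Rightarrow> (real \<Rightarrow> 'a) \<Rightarrow> (real \<Rightarrow> 'a) \<Rightarrow> bool" where
  "hamilton_solution H q p \<longleftrightarrow>
     (\<forall>t. \<forall>b\<in>Basis.
        ((\<lambda>t. q t \<bullet> b) has_real_derivative deriv (\<lambda>s. H (q t, p t + s *\<^sub>R b)) 0) (at t) \<and>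
        ((\<lambda>t. p t \<bullet> b) has_real_derivative - deriv (\<lambda>s. H (q t + s *\<^sub>R b, p t)) 0) (at t))"

text \<open>The angle is a real number, i.e. \<open>\<theta>\<close> is lifted from the circle to its universal cover.\<close>

fun kepler_H :: "real \<Rightarrow> (real \<times> real \<times> real) \<times> (real \<times> real \<times> real) \<Rightarrow> real" where
  "kepler_H \<beta> ((r, \<theta>, z), (p\<^sub>r, p\<^sub>\<theta>, p\<^sub>z)) =
     1 / 2 * (p\<^sub>r\<^sup>2 + p\<^sub>\<theta>\<^sup>2 / r\<^sup>2 + p\<^sub>z\<^sup>2) - 1 / sqrt (r\<^sup>2 + (1 + \<beta>) * z\<^sup>2)"

definition reduced_V :: "real \<Rightarrow> real \<Rightarrow> real \<Rightarrow> real \<Rightarrow> real" where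
  "reduced_V \<beta> \<omega> r z = \<omega>\<^sup>2 / (2 * r\<^sup>2) - 1 / sqrt (r\<^sup>2 + (1 + \<beta>) * z\<^sup>2)"

fun reduced_H :: "real \<Rightarrow> real \<Rightarrow> (real \<times> real) \<times> (real \<times> real) \<Rightarrow> real" where
  "reduced_H \<beta> \<omega> ((r, z), (p\<^sub>r, p\<^sub>z)) = 1 / 2 * (p\<^sub>r\<^sup>2 + p\<^sub>z\<^sup>2) + reduced_V \<beta> \<omega> r z"

definition kepler_solution ::
  "real \<Rightarrow> (real \<Rightarrow> real \<times> real \<times> real) \<Rightarrow> (real \<Rightarrow> real \<times> real \<times> real) \<Rightarrow> bool" where
  "kepler_solution \<beta> q p \<longleftrightarrow> (\<forall>t. fst (q t) > 0) \<and> hamilton_solution (kepler_H \<beta>) q p"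

definition reduced_solution ::
  "real \<Rightarrow> real \<Rightarrow> (real \<Rightarrow> real \<times> real) \<Rightarrow> (real \<Rightarrow> real \<times> real) \<Rightarrow> bool" where
  "reduced_solution \<beta> \<omega> q p \<longleftrightarrow> (\<forall>t. fst (q t) > 0) \<and> hamilton_solution (reduced_H \<beta> \<omega>) q p"

definition reduced_periodic_solution ::
  "real \<Rightarrow> real \<Rightarrow> (real \<Rightarrow> real \<times> real) \<Rightarrow> (real \<Rightarrow> real \<times> real) \<Rightarrow> bool" where
  "reduced_periodic_solution \<beta> \<omega> q p \<longleftrightarrow>
     reduced_solution \<beta> \<omega> q p \<and> (\<exists>T>0. \<forall>t. q (t + T) = q t \<and> p (t + T) = p t)"

text \<open>This covers both the periodic solutions of the full system and the quasi-periodic ones: over a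
  period \<open>T\<close> of the \<open>(r, z)\<close>-component, \<open>\<theta>\<close> increases by the integral of \<open>\<omega> / r\<^sup>2\<close>, which may or may
  not be a rational multiple of \<open>2 * pi\<close>.\<close>

definition quasi_periodic_solution ::
  "real \<Rightarrow> real \<Rightarrow> (real \<Rightarrow> real \<times> real \<times> real) \<Rightarrow> (real \<Rightarrow> real \<times> real \<times> real) \<Rightarrow> bool" where
  "quasi_periodic_solution \<beta> \<omega> q p \<longleftrightarrow>
     kepler_solution \<beta> q p \<and>
     (\<forall>t. fst (snd (p t)) = \<omega>) \<and>
     reduced_periodic_solution \<beta> \<omega>
       (\<lambda>t. (fst (q t), snd (snd (q t)))) (\<lambda>t. (fst (p t), snd (snd (p t))))"

definition planar :: "(real \<Rightarrow> real \<times> real \<times> real) \<Rightarrow> bool" where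
  "planar q \<longleftrightarrow> (\<forall>t. snd (snd (q t)) = 0)"

end

theory Submission
  imports Defs
begin

text \<open>The periodic solution is a brake orbit of the reduced system that crosses the plane \<open>z = 0\<close>
perpendicularly. It starts at rest on the boundary of the Hill region \<open>V \<le> h\<close> at a point with
\<open>z > 0\<close>, and at the first time \<open>T\<close> with \<open>z = 0\<close> it has \<open>r' = 0\<close>. Reversing time at the brake
instant gives the same motion, and so does reversing time at \<open>T\<close> and reflecting \<open>z\<close>; composing
the two symmetries gives the period \<open>4 * T\<close> (\<open>brake_motion_periodic\<close>).

Such an orbit is found by shooting. The boundary points of the Hill region are parametrised by their
radius \<open>s\<close>, from \<open>\<omega>\<^sup>2\<close>, the radius of the circular orbit, to the largest radius of the Hill region,
where \<open>z = 0\<close>. The radial velocity at the first zero of \<open>z\<close> is a continuous function of \<open>s\<close>. It is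
nonnegative for \<open>s = \<omega>\<^sup>2\<close> and nonpositive for \<open>s\<close> close to the largest radius, so it vanishes in
between (\<open>perpendicular_brake_motion_exists\<close>).

The two signs come from viewing the projection of the motion to the equatorial plane. Let \<open>\<rho>\<close> be the
square root of \<open>r\<^sup>2 + (1 + \<beta>) * z\<^sup>2\<close> and let \<open>\<theta>\<close> be the angle, with \<open>\<theta> = 0\<close> at the start.

\<^item> The Cartesian coordinate \<open>x = r * cos \<theta>\<close> satisfies \<open>x'' = - x / \<rho>\<^sup>3\<close>, whereas
  \<open>z'' = - (1 + \<beta>) * z / \<rho>\<^sup>3\<close>. Both start with velocity zero, so by Sturm comparison \<open>z\<close> vanishes
  no later than \<open>x\<close>: \<open>\<theta> T \<le> pi / 2\<close> (\<open>first_zero_before_quarter_turn\<close>).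
\<^item> The eccentricity vector \<open>(e\<^sub>x, e\<^sub>y)\<close> of the projected motion, constant in the planar Kepler problem,
  satisfies \<open>\<omega> * r' = sin \<theta> * e\<^sub>x - cos \<theta> * e\<^sub>y\<close>. Since \<open>r \<le> \<rho>\<close>, during the first quarter turn
  \<open>e\<^sub>x\<close> never decreases and \<open>e\<^sub>y\<close> never increases. At the start \<open>e\<^sub>x = \<omega>\<^sup>2 / s - 1\<close> and \<open>e\<^sub>y = 0\<close>, so
  \<open>s = \<omega>\<^sup>2\<close> gives \<open>r' \<ge> 0\<close> at time \<open>T\<close> (\<open>outward_if_started_inside\<close>).
\<^item> If \<open>s\<close> is close to the largest radius, then \<open>z\<close> is small until \<open>T\<close>, so the eccentricity vector
  stays close to its initial value, for which \<open>e\<^sub>x < 0\<close>; and \<open>\<theta> T\<close> is bounded away from \<open>0\<close>. Hence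
  \<open>r' \<le> 0\<close> at time \<open>T\<close> (\<open>inward_if_started_outside\<close>).

All motions are solutions of one globally Lipschitz equation, obtained by softening the force near
\<open>r = 0\<close>. Picard iteration gives existence for all times and Gronwall's inequality gives uniqueness and
continuous dependence; conservation of energy keeps the motions in question in the region
\<open>r \<ge> \<omega>\<^sup>2 / 2\<close>, where the force is unchanged.\<close>

section \<open>Ordinary differential equations with a Lipschitz right-hand side\<close>

text \<open>Gronwall's inequality in an inner product space: the squared distance of two solutions, divided by
\<open>exp (2 * L * t)\<close>, has a nonpositive derivative by the Cauchy-Schwarz inequality.\<close>
lemma lipschitz_ode_forward_stability:
  fixes A B :: "real \<Rightarrow> 'a::real_inner"
  assumes lip: "L-lipschitz_on UNIV F"
    and A: "\<And>t. t \<ge> 0 \<Longrightarrow> (A has_vector_derivative F (A t)) (at t)"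
    and B: "\<And>t. t \<ge> 0 \<Longrightarrow> (B has_vector_derivative F (B t)) (at t)"
    and t: "t \<ge> 0"
  shows "norm (A t - B t) \<le> exp (L * t) * norm (A 0 - B 0)"
proof -
  define q where "q s = (A s - B s) \<bullet> (A s - B s)" for s
  define \<phi> where "\<phi> s = exp (- 2 * L * s) * q s" for s
  have deriv: "\<exists>y. (\<phi> has_real_derivative y) (at s) \<and> y \<le> 0" if s: "s \<ge> 0" for s
  proof -
    define d where "d = 2 * ((A s - B s) \<bullet> (F (A s) - F (B s)))"
    have "(q has_real_derivative d) (at s)"
      unfolding q_def has_real_derivative_iff_has_vector_derivative has_vector_derivative_def d_def
      by (rule derivative_eq_intros A[OF s, unfolded has_vector_derivative_def]
          B[OF s, unfolded has_vector_derivative_def] refl)+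
         (auto simp: fun_eq_iff algebra_simps inner_commute)
    then have "(\<phi> has_real_derivative
        exp (- 2 * L * s) * (d - 2 * L * q s)) (at s)"
      unfolding \<phi>_def by (auto intro!: derivative_eq_intros simp: algebra_simps)
    moreover have "d \<le> 2 * L * q s"
    proof -
      have "(A s - B s) \<bullet> (F (A s) - F (B s)) \<le> norm (A s - B s) * norm (F (A s) - F (B s))"
        by (rule norm_cauchy_schwarz)
      also have "\<dots> \<le> norm (A s - B s) * (L * norm (A s - B s))"
        using lipschitz_on_normD[OF lip, of "A s" "B s"] by (intro mult_left_mono) auto
      also have "\<dots> = L * q s"
        by (simp add: q_def dot_square_norm power2_eq_square)
      finally show ?thesis by (simp add: d_def)
    qed
    ultimately show ?thesis
      by (intro exI[of _ "exp (- 2 * L * s) * (d - 2 * L * q s)"])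
         (auto simp: mult_nonneg_nonpos)
  qed
  have "\<phi> t \<le> \<phi> 0"
    by (rule DERIV_nonpos_imp_nonincreasing[OF t]) (use deriv in auto)
  then have "exp (- 2 * L * t) * (norm (A t - B t))\<^sup>2 \<le> (norm (A 0 - B 0))\<^sup>2"
    by (simp add: \<phi>_def q_def dot_square_norm)
  then have "exp (2 * L * t) * (exp (- 2 * L * t) * (norm (A t - B t))\<^sup>2)
      \<le> exp (2 * L * t) * (norm (A 0 - B 0))\<^sup>2"
    by (intro mult_left_mono) auto
  then have "(norm (A t - B t))\<^sup>2 \<le> (exp (L * t) * norm (A 0 - B 0))\<^sup>2"
    by (simp add: power_mult_distrib exp_double[symmetric] mult.assoc[symmetric] exp_add[symmetric])
  then show ?thesis
    by (rule power2_le_imp_le) simp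
qed

lemma has_vector_derivative_reverse_time:
  assumes "(A has_vector_derivative D) (at (c - t))"
  shows "((\<lambda>t. A (c - t)) has_vector_derivative - D) (at t)"
proof -
  have "((A \<circ> (\<lambda>t. c - t)) has_vector_derivative (-1) *\<^sub>R D) (at t)"
    by (rule vector_diff_chain_at) (auto intro!: derivative_eq_intros assms)
  then show ?thesis by (simp add: o_def)
qed

theorem lipschitz_ode_stability:
  fixes A B :: "real \<Rightarrow> 'a::real_inner"
  assumes lip: "L-lipschitz_on UNIV F"
    and A: "\<And>t. (A has_vector_derivative F (A t)) (at t)"
    and B: "\<And>t. (B has_vector_derivative F (B t)) (at t)"
  shows "norm (A t - B t) \<le> exp (L * \<bar>t\<bar>) * norm (A 0 - B 0)"
proof (cases "t \<ge> 0")
  case True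
  then show ?thesis using lipschitz_ode_forward_stability[OF lip A B True] by simp
next
  case False
  have "norm (A (0 - (- t)) - B (0 - (- t))) \<le> exp (L * (- t)) * norm (A (0 - 0) - B (0 - 0))"
    by (rule lipschitz_ode_forward_stability[where F = "\<lambda>x. - F x"])
       (use False in \<open>auto intro!: lipschitz_on_minus lip has_vector_derivative_reverse_time[of _ _ 0, simplified] A B\<close>)
  then show ?thesis using False by simp
qed

corollary lipschitz_ode_unique:
  fixes A B :: "real \<Rightarrow> 'a::real_inner"
  assumes "L-lipschitz_on UNIV F"
    and "\<And>t. (A has_vector_derivative F (A t)) (at t)"
    and "\<And>t. (B has_vector_derivative F (B t)) (at t)"
    and "A 0 = B 0"
  shows "A t = B t"
  using lipschitz_ode_stability[OF assms(1-3), of t] assms(4) by simp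

text \<open>The estimate that makes the Picard operator a contraction for the norm weighted by \<open>exp (- K * t)\<close>:
the integral of a function of size \<open>C * exp (K * s)\<close> is again of size \<open>exp (K * t)\<close>, with the
constant divided by \<open>K\<close>.\<close>
lemma norm_integral_le_exp:
  fixes g :: "real \<Rightarrow> 'a::banach"
  assumes "0 < K" "0 \<le> C" "0 \<le> t" and cont: "continuous_on {0..t} g"
    and bound: "\<And>s. s \<in> {0..t} \<Longrightarrow> norm (g s) \<le> C * exp (K * s)"
  shows "exp (- (K * t)) * norm (integral {0..t} g) \<le> C / K"
proof -
  have int: "((\<lambda>s. C * exp (K * s)) has_integral (C / K * exp (K * t) - C / K * exp (K * 0))) {0..t}"
    by (rule fundamental_theorem_of_calculus[OF \<open>0 \<le> t\<close>])
       (use \<open>0 < K\<close> in \<open>auto intro!: derivative_eq_intros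
          simp: has_real_derivative_iff_has_vector_derivative[symmetric]\<close>)
  have "norm (integral {0..t} g) \<le> integral {0..t} (\<lambda>s. C * exp (K * s))"
    by (rule integral_norm_bound_integral[OF integrable_continuous_real[OF cont]
        has_integral_integrable[OF int] bound])
  also have "\<dots> = C / K * exp (K * t) - C / K * exp (K * 0)"
    by (rule integral_unique[OF int])
  also have "\<dots> \<le> C / K * exp (K * t)"
    using \<open>0 < K\<close> \<open>0 \<le> C\<close> by simp
  finally have "exp (- (K * t)) * norm (integral {0..t} g)
      \<le> exp (- (K * t)) * (C / K * exp (K * t))"
    by (rule mult_left_mono) simp
  also have "\<dots> = C / K * (exp (- (K * t)) * exp (K * t))"
    by (simp only: ac_simps)
  also have "\<dots> = C / K"
    by (simp only: exp_minus_inverse mult.commute[of "exp (- (K * t))"] mult_1_right)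
  finally show ?thesis .
qed

lemma continuous_on_integral_max:
  fixes g :: "real \<Rightarrow> 'a::banach"
  assumes "continuous_on UNIV g"
  shows "continuous_on UNIV (\<lambda>t. integral {0..max 0 t} g)"
proof -
  have "continuous_on {0..b} (\<lambda>u. integral {0..u} g)" for b
    by (rule indefinite_integral_continuous_1)
       (auto intro!: integrable_continuous_real continuous_on_subset[OF assms])
  then have "continuous_on {..b} (\<lambda>t. integral {0..max 0 t} g)" if "b \<ge> 0" for b
    by (rule continuous_on_compose2[where g="\<lambda>u. integral {0..u} g" and t="{0..b}"])
       (use that in \<open>auto intro: continuous_on_max continuous_on_const continuous_on_id\<close>)
  then have "continuous_on {..<b} (\<lambda>t. integral {0..max 0 t} g)" if "b \<ge> 0" for b
    by (rule continuous_on_subset) (use that in auto)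
  then have "isCont (\<lambda>t. integral {0..max 0 t} g) t" for t
    by (rule continuous_on_interior[of "{..<\<bar>t\<bar> + 1}"]) (simp_all add: interior_open)
  then show ?thesis by (simp add: continuous_at_imp_continuous_on)
qed

text \<open>Picard iteration on the whole half-line at once. The unknown is \<open>y t = exp (- K * t) *\<^sub>R X t\<close>, a
bounded continuous function, and for \<open>K \<ge> 2 * L\<close> the integral equation is a contraction with
constant \<open>1/2\<close> in the supremum norm. Bounded continuous functions here live on all of \<open>real\<close>, so
negative times are clamped to \<open>0\<close>.\<close>
lemma lipschitz_ode_forward_exists:
  fixes F :: "'a::banach \<Rightarrow> 'a"
  assumes lip: "L-lipschitz_on UNIV F"
  shows "\<exists>X. X 0 = x0 \<and> (\<forall>t\<ge>0. (X has_vector_derivative F (X t)) (at t within {0..}))"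
proof -
  \<comment> \<open>The summand 1 keeps the weight positive when \<open>L = 0\<close>.\<close>
  define K where "K = 2 * (L + 1)"
  have L: "L \<ge> 0" using lip by (rule lipschitz_on_nonneg)
  then have K: "K > 0" by (simp add: K_def)
  have contF: "continuous_on UNIV F" using lip by (rule lipschitz_on_continuous_on)
  define G where "G y s = F (exp (K * s) *\<^sub>R apply_bcontfun y s)" for y s
  have contG: "continuous_on S (G y)" for y S
    unfolding G_def
    by (intro continuous_on_compose2[OF contF] continuous_intros) auto
  define P where
    "P y t = exp (- (K * max 0 t)) *\<^sub>R (x0 + integral {0..max 0 t} (G y))" for y t
  have P_bcontfun: "P y \<in> bcontfun" for y
  proof (rule bcontfun_normI)
    show "continuous_on UNIV (P y)"
      unfolding P_def by (intro continuous_intros continuous_on_integral_max contG)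
    fix t
    define C where "C = norm (F 0) + L * norm y"
    have G: "norm (G y s) \<le> C * exp (K * s)" if "s \<ge> 0" for s
    proof -
      have "norm (G y s) \<le> norm (F 0) + norm (G y s - F 0)"
        by (metis norm_triangle_sub)
      also have "norm (G y s - F 0) \<le> L * norm (exp (K * s) *\<^sub>R apply_bcontfun y s)"
        unfolding G_def using lipschitz_on_normD[OF lip, of "exp (K * s) *\<^sub>R apply_bcontfun y s" 0] by simp
      also have "\<dots> \<le> L * (exp (K * s) * norm y)"
        using L by (intro mult_left_mono) (auto intro: norm_bounded)
      also have "norm (F 0) \<le> norm (F 0) * exp (K * s)"
        using that K by (simp add: mult_le_cancel_left1)
      finally show ?thesis by (simp add: C_def algebra_simps)
    qed
    have "norm (P y t) \<le> exp (- (K * max 0 t)) * norm x0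
        + exp (- (K * max 0 t)) * norm (integral {0..max 0 t} (G y))"
      unfolding P_def by (simp add: distrib_left[symmetric] norm_triangle_ineq)
    also have "\<dots> \<le> norm x0 + C / K"
      using K L by (intro add_mono norm_integral_le_exp contG G) (auto simp: C_def intro!: mult_left_le_one_le)
    finally show "norm (P y t) \<le> norm x0 + C / K" .
  qed
  have contraction: "dist (Bcontfun (P y)) (Bcontfun (P w)) \<le> 1/2 * dist y w" for y w
  proof (rule dist_bound)
    fix t
    have G: "norm (G y s - G w s) \<le> (L * dist y w) * exp (K * s)" for s
    proof -
      have "norm (G y s - G w s)
          \<le> L * norm (exp (K * s) *\<^sub>R apply_bcontfun y s - exp (K * s) *\<^sub>R apply_bcontfun w s)"
        unfolding G_def by (rule lipschitz_on_normD[OF lip]) auto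
      also have "\<dots> = L * (exp (K * s) * dist (apply_bcontfun y s) (apply_bcontfun w s))"
        by (simp add: scaleR_diff_right[symmetric] dist_norm)
      also have "\<dots> \<le> L * (exp (K * s) * dist y w)"
        using L by (intro mult_left_mono) (auto intro: dist_bounded)
      finally show ?thesis by (simp add: algebra_simps)
    qed
    have "P y t - P w t
        = exp (- (K * max 0 t)) *\<^sub>R integral {0..max 0 t} (\<lambda>s. G y s - G w s)"
      unfolding P_def
      by (subst Henstock_Kurzweil_Integration.integral_diff)
         (auto intro!: integrable_continuous_real contG simp: algebra_simps)
    then have "dist (P y t) (P w t)
        = exp (- (K * max 0 t)) * norm (integral {0..max 0 t} (\<lambda>s. G y s - G w s))"
      by (simp add: dist_norm)
    also have "\<dots> \<le> L * dist y w / K"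
      using K L by (intro norm_integral_le_exp continuous_intros contG G) auto
    also have "\<dots> \<le> 1/2 * dist y w"
      using L K mult_right_mono[of "2 * L" K "dist y w"] by (simp add: K_def field_simps)
    finally show "dist (apply_bcontfun (Bcontfun (P y)) t) (apply_bcontfun (Bcontfun (P w)) t)
        \<le> 1/2 * dist y w"
      by (simp add: Bcontfun_inverse P_bcontfun)
  qed
  have "\<exists>!y. Bcontfun (P y) = y"
    by (rule banach_fix_type[of "1/2"]) (use contraction in auto)
  then obtain y where "Bcontfun (P y) = y" by auto
  then have fix_y: "apply_bcontfun y = P y"
    by (metis Bcontfun_inverse P_bcontfun)
  define X where "X t = exp (K * t) *\<^sub>R apply_bcontfun y t" for t
  have GX: "G y = (\<lambda>s. F (X s))" by (simp add: fun_eq_iff G_def X_def)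
  have X: "X t = x0 + integral {0..t} (\<lambda>s. F (X s))" if "t \<ge> 0" for t
    using that unfolding X_def[of t] fix_y P_def GX by (simp add: exp_minus max_def)
  have "(X has_vector_derivative F (X t)) (at t within {0..})" if t: "t \<ge> 0" for t
  proof -
    have "((\<lambda>u. x0 + integral {0..u} (\<lambda>s. F (X s))) has_vector_derivative 0 + F (X t))
        (at t within {0..t + 1})"
      by (intro has_vector_derivative_add has_vector_derivative_const
          integral_has_vector_derivative contG[of _ y, unfolded GX]) (use t in auto)
    then have "(X has_vector_derivative F (X t)) (at t within {0..t + 1})"
      by (simp add: has_vector_derivative_def)
         (erule has_derivative_transform[rotated 2]; use t X in auto)
    moreover have "at t within {0..} = at t within {0..t + 1}"
      by (rule at_within_nhd[of _ "{..<t + 1}"]) (use t in auto)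
    ultimately show ?thesis by simp
  qed
  then show ?thesis using X[of 0] by auto
qed

text \<open>A solution for negative times is a forward solution of the reversed field; the two halves have the
same one-sided derivative at \<open>0\<close>.\<close>
theorem lipschitz_ode_exists:
  fixes F :: "'a::banach \<Rightarrow> 'a"
  assumes lip: "L-lipschitz_on UNIV F"
  shows "\<exists>X. X 0 = x0 \<and> (\<forall>t. (X has_vector_derivative F (X t)) (at t))"
proof -
  obtain A where A: "A 0 = x0" "\<And>t. t \<ge> 0 \<Longrightarrow> (A has_vector_derivative F (A t)) (at t within {0..})"
    using lipschitz_ode_forward_exists[OF lip] by metis
  obtain B where B: "B 0 = x0"
    "\<And>t. t \<ge> 0 \<Longrightarrow> (B has_vector_derivative - F (B t)) (at t within {0..})"
    using lipschitz_ode_forward_exists[OF lipschitz_on_minus[OF lip]] by metis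
  have B': "((\<lambda>t. B (- t)) has_vector_derivative F (B (- t))) (at t within {..0})" if "t \<le> 0" for t
  proof -
    have "((B \<circ> uminus) has_vector_derivative (-1) *\<^sub>R (- F (B (- t)))) (at t within {..0})"
    proof (rule vector_diff_chain_within)
      show "(B has_vector_derivative - F (B (- t))) (at (- t) within uminus ` {..0})"
        using B(2)[of "- t"] that by simp
    qed (auto intro!: derivative_eq_intros)
    then show ?thesis by (simp add: o_def)
  qed
  define X where "X t = (if t \<in> {0..} then A t else B (- t))" for t
  have "(X has_vector_derivative (if t \<in> {0..} then F (A t) else F (B (- t)))) (at t within UNIV)" for t
    unfolding X_def
  proof (rule has_vector_derivative_If_within_closures[where T = "{..0}"])
    have eqs: "{0..} \<union> ({0..} \<inter> {..0}) = {0::real..}" "{..0} \<union> ({0..} \<inter> {..0}) = {..0::real}"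
      by auto
    show "(A has_vector_derivative F (A t)) (at t within {0..} \<union> (closure {0..} \<inter> closure {..0}))"
      if "t \<in> {0..} \<union> (closure {0..} \<inter> closure {..0})"
      using A(2)[of t] that eqs by auto
    show "((\<lambda>t. B (- t)) has_vector_derivative F (B (- t)))
        (at t within {..0} \<union> (closure {0..} \<inter> closure {..0}))"
      if "t \<in> {..0} \<union> (closure {0..} \<inter> closure {..0})"
      using B'[of t] that eqs by auto
  qed (use A(1) B(1) in auto)
  then have "(X has_vector_derivative F (X t)) (at t)" for t
    by (simp add: X_def if_distrib)
  moreover have "X 0 = x0" by (simp add: X_def A)
  ultimately show ?thesis by blast
qed

section \<open>First zeros depending on a parameter\<close>

definition first_zero :: "(real \<Rightarrow> real) \<Rightarrow> real \<Rightarrow> bool" where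
  "first_zero f T \<longleftrightarrow> 0 < T \<and> f T = 0 \<and> (\<forall>t\<in>{0..<T}. 0 < f t)"

lemma first_zero_exists:
  assumes cont: "continuous_on {0..b} f" and "f 0 > 0" "b \<ge> 0" "f b \<le> 0"
  shows "\<exists>T\<le>b. first_zero f T"
proof -
  define S where "S = {0..b} \<inter> f -` {..0}"
  have "closed S"
    unfolding S_def by (rule continuous_closed_preimage[OF cont]) auto
  then have "compact S"
    unfolding S_def by (metis Int_absorb2 bounded_Int bounded_closed_interval closed_real_atLeastAtMost
        compact_eq_bounded_closed inf_le1)
  moreover have "b \<in> S" using assms by (auto simp: S_def)
  ultimately obtain T where T: "T \<in> S" "\<And>t. t \<in> S \<Longrightarrow> T \<le> t"
    using compact_attains_inf[of S] by auto
  have pos: "f t > 0" if "t \<in> {0..<T}" for t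
    using T(2)[of t] T(1) that by (force simp: S_def)
  have "T > 0" using T(1) \<open>f 0 > 0\<close> by (cases "T = 0") (auto simp: S_def)
  moreover have "f T \<ge> 0"
  proof (rule ccontr)
    assume "\<not> f T \<ge> 0"
    moreover have "continuous_on {0..T} f"
      using T(1) by (intro continuous_on_subset[OF cont]) (auto simp: S_def)
    ultimately obtain t where "t \<in> {0..T}" "f t = 0"
      using IVT2'[of f T 0 0] \<open>T > 0\<close> \<open>f 0 > 0\<close> by auto
    with pos[of t] \<open>\<not> f T \<ge> 0\<close> show False by (cases "t = T") auto
  qed
  ultimately show ?thesis
    using T(1) pos unfolding first_zero_def S_def by (intro exI[of _ T]) auto
qed

text \<open>The first zero is continuous because the functions become negative immediately after it: near a
parameter \<open>s\<close>, the sign change just after \<open>T s\<close> persists, which bounds the zero from above, and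
positivity persists uniformly on the compact interval before \<open>T s\<close>, which bounds it from below.\<close>
lemma continuous_first_zero:
  fixes f :: "real \<Rightarrow> real \<Rightarrow> real"
  assumes cont: "continuous_on (S \<times> UNIV) (\<lambda>(s, t). f s t)"
    and zero: "\<And>s. s \<in> S \<Longrightarrow> first_zero (f s) (T s)"
    and cross: "\<And>s e. s \<in> S \<Longrightarrow> e > 0 \<Longrightarrow> \<exists>t\<in>{T s<..<T s + e}. f s t < 0"
  shows "continuous_on S T"
  unfolding continuous_on_iff
proof (intro ballI allI impI)
  fix s e :: real
  assume s: "s \<in> S" and "e > 0"
  have cont_s: "continuous_on S (\<lambda>s. f s t)" for t
    by (rule continuous_on_compose2[OF cont, of S "\<lambda>s. (s, t)", simplified])
       (auto intro: continuous_intros)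
  obtain t1 where t1: "T s < t1" "t1 < T s + e" "f s t1 < 0"
    using cross[OF s \<open>e > 0\<close>] by auto
  obtain d1 where d1: "d1 > 0" "\<And>s'. s' \<in> S \<Longrightarrow> dist s' s < d1 \<Longrightarrow> f s' t1 < 0"
  proof -
    have "\<forall>\<^sub>F s' in at s within S. f s' t1 < 0"
      using cont_s[of t1] s t1(3) by (auto simp: continuous_on_def intro: order_tendstoD(2))
    then obtain d where "d > 0" "\<And>s'. s' \<in> S \<Longrightarrow> s' \<noteq> s \<Longrightarrow> dist s' s < d \<Longrightarrow> f s' t1 < 0"
      by (auto simp: eventually_at)
    with t1(3) show ?thesis using that[of d] by metis
  qed
  obtain d2 where d2: "d2 > 0"
    "\<And>s' t. s' \<in> S \<Longrightarrow> dist s' s < d2 \<Longrightarrow> t \<in> {0..T s - e} \<Longrightarrow> f s' t > 0"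
  proof -
    have "\<exists>X0. s \<in> X0 \<and> open X0 \<and> (\<forall>s'\<in>X0 \<inter> S. \<forall>t\<in>{0..T s - e}. f s' t > 0)"
    proof -
      have "openin (top_of_set (S \<times> {0..T s - e}))
          ((S \<times> {0..T s - e}) \<inter> (\<lambda>(s, t). f s t) -` {0<..})"
        by (rule continuous_openin_preimage_gen[OF continuous_on_subset[OF cont]]) auto
      then obtain W where W: "open W"
        "(S \<times> {0..T s - e}) \<inter> (\<lambda>(s, t). f s t) -` {0<..} = (S \<times> {0..T s - e}) \<inter> W"
        unfolding openin_open by auto
      have "{s} \<times> {0..T s - e} \<subseteq> W"
      proof (clarify)
        fix t assume "t \<in> {0..T s - e}"
        then have "(s, t) \<in> (S \<times> {0..T s - e}) \<inter> (\<lambda>(s, t). f s t) -` {0<..}"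
          using zero[OF s] s \<open>e > 0\<close> by (auto simp: first_zero_def)
        then show "(s, t) \<in> W" unfolding W(2) by blast
      qed
      then obtain X0 where "s \<in> X0" "open X0" "X0 \<times> {0..T s - e} \<subseteq> W"
        using Elementary_Topology.tube_lemma[of "{0..T s - e}" W s] \<open>open W\<close> by auto
      with W(2) show ?thesis by (intro exI[of _ X0]) auto
    qed
    then obtain X0 where X0: "s \<in> X0" "open X0" "\<forall>s'\<in>X0 \<inter> S. \<forall>t\<in>{0..T s - e}. f s' t > 0"
      by blast
    then obtain d where "d > 0" "ball s d \<subseteq> X0" by (meson openE)
    with X0(3) show ?thesis
      using that[of d] by (auto simp: dist_commute subset_iff)
  qed
  have "dist (T s') (T s) < e" if s': "s' \<in> S" "dist s' s < min d1 d2" for s'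
  proof -
    have "T s' \<le> t1"
    proof (rule ccontr)
      assume "\<not> T s' \<le> t1"
      then have "f s' t1 > 0"
        using zero[OF s'(1)] zero[OF s] t1(1) by (auto simp: first_zero_def)
      with d1(2)[of s'] s' show False by auto
    qed
    moreover have "T s - e < T s'"
    proof (rule ccontr)
      assume "\<not> T s - e < T s'"
      then have "f s' (T s') > 0"
        using zero[OF s'(1)] s' by (intro d2(2)) (auto simp: first_zero_def)
      then show False using zero[OF s'(1)] by (auto simp: first_zero_def)
    qed
    ultimately show ?thesis using t1 by (auto simp: dist_real_def)
  qed
  then show "\<exists>d>0. \<forall>x'\<in>S. dist x' s < d \<longrightarrow> dist (T x') (T s) < e"
    using d1(1) d2(1) by (intro exI[of _ "min d1 d2"]) auto
qed

section \<open>Global solutions of the reduced system\<close>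

definition eff_dist :: "real \<Rightarrow> real \<Rightarrow> real \<Rightarrow> real" where
  "eff_dist \<beta> r z = sqrt (r\<^sup>2 + (1 + \<beta>) * z\<^sup>2)"

text \<open>The reduced equations of motion written as a first-order system; \<open>u\<close> and \<open>v\<close> are the velocities of
\<open>r\<close> and \<open>z\<close>.\<close>
definition reduced_motion ::
  "real \<Rightarrow> real \<Rightarrow> (real \<Rightarrow> real) \<Rightarrow> (real \<Rightarrow> real) \<Rightarrow> (real \<Rightarrow> real) \<Rightarrow> (real \<Rightarrow> real) \<Rightarrow> bool" where
  "reduced_motion \<beta> \<omega> r z u v \<longleftrightarrow> (\<forall>t. r t > 0 \<and>
     (r has_real_derivative u t) (at t) \<and>
     (z has_real_derivative v t) (at t) \<and>
     (u has_real_derivative \<omega>\<^sup>2 / r t ^ 3 - r t / eff_dist \<beta> (r t) (z t) ^ 3) (at t) \<and>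
     (v has_real_derivative - ((1 + \<beta>) * z t / eff_dist \<beta> (r t) (z t) ^ 3)) (at t))"

text \<open>With \<open>i = 1 / m\<close> and \<open>j = 1 / n\<close> this is the factorisation of \<open>i ^ 3 - j ^ 3\<close>. The factor \<open>m\<close> on the
left absorbs the norm of the vector in \<open>soft_kernel\<close>.\<close>
lemma inverse_cube_increment:
  fixes a m n :: real
  assumes "a > 0" "m \<ge> a" "n \<ge> a"
  shows "m * \<bar>1 / m ^ 3 - 1 / n ^ 3\<bar> \<le> 3 / a ^ 3 * \<bar>m - n\<bar>"
proof -
  define i j where "i = 1 / m" and "j = 1 / n"
  have ij: "0 < i" "i \<le> 1 / a" "0 < j" "j \<le> 1 / a"
    using assms by (auto simp: i_def j_def intro: divide_left_mono)
  have inv: "m * i = 1" "n * j = 1" using assms by (simp_all add: i_def j_def)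
  have cubes: "1 / m ^ 3 = i ^ 3" "1 / n ^ 3 = j ^ 3"
    by (simp_all add: i_def j_def power_one_over)
  have "m * (i ^ 3 - j ^ 3) = (n - m) * (j * i * i + j * j * i + j * j * j)"
    using inv by algebra
  then have "\<bar>m\<bar> * \<bar>i ^ 3 - j ^ 3\<bar> = \<bar>n - m\<bar> * \<bar>j * i * i + j * j * i + j * j * j\<bar>"
    by (simp only: abs_mult[symmetric])
  moreover have "j * i * i + j * j * i + j * j * j \<ge> 0"
    using ij by (intro add_nonneg_nonneg mult_nonneg_nonneg) auto
  ultimately have "m * \<bar>1 / m ^ 3 - 1 / n ^ 3\<bar> = \<bar>m - n\<bar> * (j * i * i + j * j * i + j * j * j)"
    using assms unfolding cubes by (simp only: abs_of_nonneg abs_minus_commute[of n m])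
  also have "\<dots> \<le> \<bar>m - n\<bar> * (1/a * (1/a) * (1/a) + 1/a * (1/a) * (1/a) + 1/a * (1/a) * (1/a))"
    using ij \<open>a > 0\<close> by (intro mult_left_mono add_mono mult_mono) auto
  finally show ?thesis by (simp add: power3_eq_cube field_simps)
qed

text \<open>The Kepler force field \<open>x / norm x ^ 3\<close>, made linear inside the ball of radius \<open>a\<close>.\<close>
definition soft_kernel :: "real \<Rightarrow> 'a::real_normed_vector \<Rightarrow> 'a" where
  "soft_kernel a x = (1 / max (norm x) a ^ 3) *\<^sub>R x"

lemma lipschitz_soft_kernel:
  assumes "a > 0"
  shows "(4 / a ^ 3)-lipschitz_on UNIV (soft_kernel a)"
proof (rule lipschitz_onI)
  fix x y :: 'a
  define m n where "m = max (norm x) a" and "n = max (norm y) a"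
  have mn: "m \<ge> a" "n \<ge> a" "norm x \<le> m" by (auto simp: m_def n_def)
  have "\<bar>m - n\<bar> \<le> \<bar>norm x - norm y\<bar>" by (auto simp: m_def n_def)
  also have "\<dots> \<le> dist x y" by (simp add: dist_norm norm_triangle_ineq3)
  finally have lip: "\<bar>m - n\<bar> \<le> dist x y" .
  have "soft_kernel a x - soft_kernel a y = (1 / n ^ 3) *\<^sub>R (x - y) + (1 / m ^ 3 - 1 / n ^ 3) *\<^sub>R x"
    by (simp add: soft_kernel_def m_def n_def algebra_simps)
  then have "dist (soft_kernel a x) (soft_kernel a y)
      \<le> norm ((1 / n ^ 3) *\<^sub>R (x - y)) + norm ((1 / m ^ 3 - 1 / n ^ 3) *\<^sub>R x)"
    by (simp only: dist_norm norm_triangle_ineq)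
  also have "norm ((1 / n ^ 3) *\<^sub>R (x - y)) \<le> 1 / a ^ 3 * dist x y"
    using mn assms by (auto simp: dist_norm divide_right_mono intro!: mult_right_mono divide_left_mono power_mono)
  also have "norm ((1 / m ^ 3 - 1 / n ^ 3) *\<^sub>R x) \<le> m * \<bar>1 / m ^ 3 - 1 / n ^ 3\<bar>"
    using mn by (simp add: mult.commute mult_right_mono)
  also have "\<dots> \<le> 3 / a ^ 3 * dist x y"
    using inverse_cube_increment[OF assms mn(1,2)] mult_left_mono[OF lip, of "3 / a ^ 3"] assms
    by simp
  finally show "dist (soft_kernel a x) (soft_kernel a y) \<le> 4 / a ^ 3 * dist x y"
    by (simp add: field_simps)
qed (use assms in simp)

lemma lipschitz_soft_inverse_cube:
  assumes "a > 0"
  shows "(3 / a ^ 4)-lipschitz_on UNIV (\<lambda>x::real. 1 / max x a ^ 3)"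
proof (rule lipschitz_onI)
  fix x y :: real
  define m n where "m = max x a" and "n = max y a"
  have mn: "m \<ge> a" "n \<ge> a" "\<bar>m - n\<bar> \<le> dist x y" by (auto simp: m_def n_def dist_real_def)
  have "a * \<bar>1 / m ^ 3 - 1 / n ^ 3\<bar> \<le> m * \<bar>1 / m ^ 3 - 1 / n ^ 3\<bar>"
    using mn by (intro mult_right_mono) auto
  also have "\<dots> \<le> 3 / a ^ 3 * \<bar>m - n\<bar>"
    by (rule inverse_cube_increment[OF assms mn(1,2)])
  also have "\<dots> \<le> 3 / a ^ 3 * dist x y"
    using mn assms by (intro mult_left_mono) auto
  finally have "\<bar>1 / m ^ 3 - 1 / n ^ 3\<bar> \<le> (3 / a ^ 3 * dist x y) / a"
    using assms by (simp only: pos_le_divide_eq mult.commute)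
  also have "\<dots> = 3 / a ^ 4 * dist x y"
    by (simp add: power_numeral_reduce)
  finally show "dist (1 / max x a ^ 3) (1 / max y a ^ 3) \<le> 3 / a ^ 4 * dist x y"
    by (simp only: m_def n_def dist_real_def)
qed (use assms in simp)

text \<open>The reduced equations with both singular terms softened. In the rescaled coordinates
\<open>(r, sqrt (1 + \<beta>) * z)\<close> the attraction is the isotropic Kepler force.\<close>
definition soft_field :: "real \<Rightarrow> real \<Rightarrow> real \<Rightarrow> real \<times> real \<times> real \<times> real \<Rightarrow> real \<times> real \<times> real \<times> real" where
  "soft_field a \<beta> \<omega> x =
     (let k = soft_kernel a (fst x, sqrt (1 + \<beta>) * fst (snd x)) in
      (fst (snd (snd x)), snd (snd (snd x)),
       \<omega>\<^sup>2 * (1 / max (fst x) a ^ 3) - fst k, - (sqrt (1 + \<beta>) * snd k)))"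

lemma lipschitz_soft_field:
  assumes "a > 0"
  shows "\<exists>L. L-lipschitz_on UNIV (soft_field a \<beta> \<omega>)"
proof -
  have fst: "1-lipschitz_on UNIV (fst :: 'p::metric_space \<times> 'q::metric_space \<Rightarrow> 'p)"
    and snd: "1-lipschitz_on UNIV (snd :: 'p::metric_space \<times> 'q::metric_space \<Rightarrow> 'q)"
    by (intro lipschitz_onI; simp only: dist_fst_le dist_snd_le mult_1 zero_le_one)+
  have lc: "(D * C)-lipschitz_on UNIV (\<lambda>x. g (f x))"
    if "D-lipschitz_on UNIV g" "C-lipschitz_on UNIV f"
    for C D :: real and f :: "'p::metric_space \<Rightarrow> 'q::metric_space" and g :: "'q \<Rightarrow> 'r::metric_space"
    using lipschitz_on_compose2[OF that(2) lipschitz_on_subset[OF that(1)]] by simp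
  show ?thesis
    unfolding soft_field_def Let_def
    by (rule exI)
       (rule lipschitz_on_Pair lipschitz_on_diff lipschitz_on_minus lipschitz_on_cmult_real
         lc[OF lipschitz_soft_kernel[OF assms]] lc[OF lipschitz_soft_inverse_cube[OF assms]]
         fst snd lc[OF fst] lc[OF snd])+
qed

lemma eff_dist_ge:
  assumes "\<beta> > -1" "r > 0"
  shows "r \<le> eff_dist \<beta> r z"
  unfolding eff_dist_def using assms by (intro real_le_rsqrt) simp

lemma soft_field_eq:
  assumes "\<beta> > -1" "a > 0" "r \<ge> a"
  shows "soft_field a \<beta> \<omega> (r, z, u, v) =
    (u, v, \<omega>\<^sup>2 / r ^ 3 - r / eff_dist \<beta> r z ^ 3, - ((1 + \<beta>) * z / eff_dist \<beta> r z ^ 3))"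
proof -
  have norm_eq: "norm (r, sqrt (1 + \<beta>) * z) = eff_dist \<beta> r z"
    using assms by (simp add: norm_Pair eff_dist_def power_mult_distrib)
  have "max (eff_dist \<beta> r z) a = eff_dist \<beta> r z" "max r a = r"
    using eff_dist_ge[of \<beta> r z] assms by auto
  then show ?thesis
    using assms by (simp add: soft_field_def soft_kernel_def norm_eq)
qed

text \<open>Conservation of energy is stated at a single time, because for solutions of the softened equations
the true equations of motion are at first known only while \<open>r\<close> exceeds the softening radius.\<close>
lemma energy_has_derivative_0:
  assumes "\<beta> > -1" "r t > 0"
    and "(r has_real_derivative u t) (at t)" "(z has_real_derivative v t) (at t)"
    and "(u has_real_derivative \<omega>\<^sup>2 / r t ^ 3 - r t / eff_dist \<beta> (r t) (z t) ^ 3) (at t)"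
    and "(v has_real_derivative - ((1 + \<beta>) * z t / eff_dist \<beta> (r t) (z t) ^ 3)) (at t)"
  shows "((\<lambda>t. reduced_H \<beta> \<omega> ((r t, z t), (u t, v t))) has_real_derivative 0) (at t)"
proof -
  define S where "S t = (r t)\<^sup>2 + (1 + \<beta>) * (z t)\<^sup>2" for t
  have S: "S t > 0" using assms(1,2) by (simp add: S_def add_pos_nonneg)
  have e3: "eff_dist \<beta> (r t) (z t) ^ 3 = S t * sqrt (S t)"
    using S by (simp add: eff_dist_def S_def power3_eq_cube)
  note d = assms(3-)[unfolded e3]
  have "(S has_real_derivative 2 * r t * u t + (1 + \<beta>) * (2 * z t * v t)) (at t)"
    unfolding S_def by (rule derivative_eq_intros d refl)+ simp
  then have "((\<lambda>t. sqrt (S t)) has_real_derivative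
      inverse (sqrt (S t)) / 2 * (2 * r t * u t + (1 + \<beta>) * (2 * z t * v t))) (at t)"
    by (rule DERIV_chain2[where f = sqrt and g = S, OF DERIV_real_sqrt[OF S]])
  then have "((\<lambda>t. inverse (sqrt (S t))) has_real_derivative
      - ((r t * u t + (1 + \<beta>) * (z t * v t)) / (S t * sqrt (S t)))) (at t)"
    by (rule DERIV_inverse_fun[THEN DERIV_cong]) (use S in \<open>simp_all add: field_simps\<close>)
  moreover have "((\<lambda>t. \<omega>\<^sup>2 / (2 * (r t)\<^sup>2)) has_real_derivative - (\<omega>\<^sup>2 / r t ^ 3 * u t)) (at t)"
    by (rule derivative_eq_intros d refl)+
       (use assms(2) in \<open>simp_all add: field_simps power2_eq_square power3_eq_cube\<close>)
  moreover have "((\<lambda>t. 1 / 2 * ((u t)\<^sup>2 + (v t)\<^sup>2)) has_real_derivative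
      (\<omega>\<^sup>2 / r t ^ 3 - r t / (S t * sqrt (S t))) * u t - (1 + \<beta>) * z t / (S t * sqrt (S t)) * v t) (at t)"
    by (rule derivative_eq_intros d refl)+ (simp add: algebra_simps)
  ultimately have "((\<lambda>t. 1 / 2 * ((u t)\<^sup>2 + (v t)\<^sup>2) + (\<omega>\<^sup>2 / (2 * (r t)\<^sup>2) - inverse (sqrt (S t))))
      has_real_derivative (\<omega>\<^sup>2 / r t ^ 3 - r t / (S t * sqrt (S t))) * u t
        - (1 + \<beta>) * z t / (S t * sqrt (S t)) * v t + (- (\<omega>\<^sup>2 / r t ^ 3 * u t)
        - - ((r t * u t + (1 + \<beta>) * (z t * v t)) / (S t * sqrt (S t))))) (at t)"
    by (intro DERIV_add DERIV_diff)
  moreover have "(\<omega>\<^sup>2 / r t ^ 3 - r t / (S t * sqrt (S t))) * u t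
        - (1 + \<beta>) * z t / (S t * sqrt (S t)) * v t + (- (\<omega>\<^sup>2 / r t ^ 3 * u t)
        - - ((r t * u t + (1 + \<beta>) * (z t * v t)) / (S t * sqrt (S t)))) = 0"
    by (simp add: algebra_simps add_divide_distrib diff_divide_distrib)
  ultimately show ?thesis
    unfolding reduced_H.simps reduced_V_def S_def by (simp add: inverse_eq_divide)
qed

text \<open>On \<open>V \<le> h\<close> one has \<open>\<omega>\<^sup>2 / (2 * r\<^sup>2) - h \<le> 1 / \<rho>\<close>. Dropping the first term bounds \<open>\<rho>\<close>; dropping
\<open>h\<close> and using \<open>r \<le> \<rho>\<close> bounds \<open>r\<close> from below.\<close>
lemma Hill_region_bounds:
  assumes "\<beta> > -1" "r > 0" "h < 0" "reduced_H \<beta> \<omega> ((r, z), (u, v)) \<le> h"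
  shows "\<omega>\<^sup>2 / 2 \<le> r" and "eff_dist \<beta> r z \<le> - 1 / h"
proof -
  define \<rho> where "\<rho> = eff_dist \<beta> r z"
  have \<rho>: "r \<le> \<rho>" unfolding \<rho>_def by (rule eff_dist_ge[OF assms(1,2)])
  have "0 \<le> 1 / 2 * (u\<^sup>2 + v\<^sup>2)" by simp
  then have *: "\<omega>\<^sup>2 / (2 * r\<^sup>2) - h \<le> 1 / \<rho>"
    using assms(4) unfolding reduced_H.simps reduced_V_def \<rho>_def eff_dist_def by argo
  then have "\<omega>\<^sup>2 / (2 * r\<^sup>2) \<le> 1 / r"
    using \<rho> assms(2,3) divide_left_mono[of r \<rho> 1] by simp
  then show "\<omega>\<^sup>2 / 2 \<le> r"
    using assms(2) by (simp add: field_simps power2_eq_square)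
  have "0 \<le> \<omega>\<^sup>2 / (2 * r\<^sup>2)" by simp
  then have "- h \<le> 1 / \<rho>" using * by linarith
  then show "eff_dist \<beta> r z \<le> - 1 / h"
    using \<rho> assms(2,3) by (simp add: \<rho>_def[symmetric] field_simps)
qed

text \<open>A continuity argument: \<open>e\<close> is conserved as long as \<open>r > a\<close>, and conservation of \<open>e\<close> forces \<open>r\<close> to be
not only above \<open>a\<close> but above the larger value \<open>c\<close>. Thus the set of times at which \<open>r \<ge> c\<close> and \<open>e\<close>
has its initial value is open and closed.\<close>
lemma barrier_from_conserved_quantity:
  fixes r e :: "real \<Rightarrow> real"
  assumes cont: "continuous_on UNIV r" and "a < c" "c \<le> r 0"
    and e: "\<And>t. r t > a \<Longrightarrow> (e has_real_derivative 0) (at t)"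
    and barrier: "\<And>t. r t > a \<Longrightarrow> e t = e 0 \<Longrightarrow> r t \<ge> c"
  shows "r t \<ge> c"
proof -
  define S where "S = {t. r t \<ge> c \<and> e t = e 0}"
  have above: "open {t. r t > a}"
    using cont by (intro open_Collect_less) auto
  have "open S"
    unfolding open_contains_ball
  proof
    fix t assume t: "t \<in> S"
    then have "t \<in> {t. r t > a}" using \<open>a < c\<close> by (auto simp: S_def)
    then obtain d where d: "d > 0" "ball t d \<subseteq> {t. r t > a}"
      using above by (meson openE)
    have "e s = e t" if "s \<in> ball t d" for s
      by (rule DERIV_zero_connected_constant[of "ball t d" "{}" e])
         (use d e that in \<open>auto intro!: continuous_at_imp_continuous_on DERIV_isCont\<close>)
    then have "ball t d \<subseteq> S"
      using t d(2) barrier by (fastforce simp: S_def)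
    then show "\<exists>d>0. ball t d \<subseteq> S" using d(1) by blast
  qed
  moreover have "open (- S)"
    unfolding open_contains_ball
  proof
    fix t assume t: "t \<in> - S"
    show "\<exists>d>0. ball t d \<subseteq> - S"
    proof (cases "r t < c")
      case True
      have "open {t. r t < c}" using cont by (intro open_Collect_less) auto
      then obtain d where "d > 0" "ball t d \<subseteq> {t. r t < c}"
        using True by (metis openE mem_Collect_eq)
      then show ?thesis by (force simp: S_def)
    next
      case False
      with t have "e t \<noteq> e 0" by (auto simp: S_def)
      moreover have "isCont e t" using False \<open>a < c\<close> by (intro DERIV_isCont[OF e]) auto
      ultimately have "\<forall>\<^sub>F s in at t. e s \<noteq> e 0"
        by (auto simp: isCont_def intro: tendsto_imp_eventually_ne)
      then obtain d where "d > 0" "\<forall>s. s \<noteq> t \<and> dist s t < d \<longrightarrow> e s \<noteq> e 0"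
        by (auto simp: eventually_at)
      with \<open>e t \<noteq> e 0\<close> show ?thesis
        by (intro exI[of _ d]) (auto simp: S_def dist_commute)
    qed
  qed
  ultimately have "S = {} \<or> S = UNIV"
    by (metis clopen closed_def)
  moreover have "0 \<in> S" using \<open>c \<le> r 0\<close> by (simp add: S_def)
  ultimately show ?thesis by (auto simp: S_def)
qed

lemma has_vector_derivative_quadruple:
  fixes r z u v :: "real \<Rightarrow> real"
  shows "((\<lambda>t. (r t, z t, u t, v t)) has_vector_derivative (a, b, c, d)) (at t) \<longleftrightarrow>
    (r has_real_derivative a) (at t) \<and> (z has_real_derivative b) (at t) \<and>
    (u has_real_derivative c) (at t) \<and> (v has_real_derivative d) (at t)" (is "?L \<longleftrightarrow> ?R")
proof
  assume L: ?L
  note f = bounded_linear.has_vector_derivative[OF bounded_linear_fst]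
    and s = bounded_linear.has_vector_derivative[OF bounded_linear_snd]
  show ?R
    using f[OF L] f[OF s[OF L]] f[OF s[OF s[OF L]]] s[OF s[OF s[OF L]]]
    by (simp add: has_real_derivative_iff_has_vector_derivative)
next
  assume ?R
  then show ?L
    by (intro has_vector_derivative_Pair) (simp_all add: has_real_derivative_iff_has_vector_derivative)
qed

lemma reduced_motion_iff_soft_solution:
  assumes "\<beta> > -1" "a > 0" "\<And>t. r t \<ge> a"
  shows "reduced_motion \<beta> \<omega> r z u v \<longleftrightarrow> (\<forall>t. ((\<lambda>t. (r t, z t, u t, v t)) has_vector_derivative
    soft_field a \<beta> \<omega> (r t, z t, u t, v t)) (at t))"
proof -
  have "r t > 0" for t using assms(2) assms(3)[of t] by linarith
  then show ?thesis
    unfolding reduced_motion_def soft_field_eq[OF assms] has_vector_derivative_quadruple by auto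
qed

lemma reduced_motion_energy:
  assumes "\<beta> > -1" "reduced_motion \<beta> \<omega> r z u v"
  shows "reduced_H \<beta> \<omega> ((r t, z t), (u t, v t)) = reduced_H \<beta> \<omega> ((r 0, z 0), (u 0, v 0))"
  using assms
  by (intro DERIV_isconst_all[where f = "\<lambda>t. reduced_H \<beta> \<omega> ((r t, z t), (u t, v t))"]
      allI energy_has_derivative_0) (auto simp: reduced_motion_def)

lemma reduced_motion_bounds:
  assumes "\<beta> > -1" "reduced_motion \<beta> \<omega> r z u v" "h < 0"
    and "reduced_H \<beta> \<omega> ((r 0, z 0), (u 0, v 0)) = h"
  shows "\<omega>\<^sup>2 / 2 \<le> r t" and "eff_dist \<beta> (r t) (z t) \<le> - 1 / h"
  using Hill_region_bounds[of \<beta> "r t" h \<omega> "z t" "u t" "v t"]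
    reduced_motion_energy[OF assms(1,2), of t] assms
  by (auto simp: reduced_motion_def)

lemma reduced_motion_unique:
  assumes "\<beta> > -1" "\<omega> \<noteq> 0" and "reduced_H \<beta> \<omega> ((r 0, z 0), (u 0, v 0)) < 0"
    and motion: "reduced_motion \<beta> \<omega> r z u v" "reduced_motion \<beta> \<omega> r' z' u' v'"
    and init: "r 0 = r' 0" "z 0 = z' 0" "u 0 = u' 0" "v 0 = v' 0"
  shows "r t = r' t \<and> z t = z' t \<and> u t = u' t \<and> v t = v' t"
proof -
  have a: "\<omega>\<^sup>2 / 2 > 0" using \<open>\<omega> \<noteq> 0\<close> by simp
  obtain L where L: "L-lipschitz_on UNIV (soft_field (\<omega>\<^sup>2 / 2) \<beta> \<omega>)"
    using lipschitz_soft_field[OF a] by blast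
  have "(r t, z t, u t, v t) = (r' t, z' t, u' t, v' t)"
  proof (rule lipschitz_ode_unique[OF L, where A = "\<lambda>t. (r t, z t, u t, v t)"
        and B = "\<lambda>t. (r' t, z' t, u' t, v' t)"])
    have "\<omega>\<^sup>2 / 2 \<le> r t" "\<omega>\<^sup>2 / 2 \<le> r' t" for t
      using reduced_motion_bounds(1)[OF assms(1) motion(1) assms(3) refl]
        reduced_motion_bounds(1)[OF assms(1) motion(2) assms(3)] init by auto
    then show "((\<lambda>t. (r t, z t, u t, v t)) has_vector_derivative
        soft_field (\<omega>\<^sup>2 / 2) \<beta> \<omega> (r t, z t, u t, v t)) (at t)"
      and "((\<lambda>t. (r' t, z' t, u' t, v' t)) has_vector_derivative
        soft_field (\<omega>\<^sup>2 / 2) \<beta> \<omega> (r' t, z' t, u' t, v' t)) (at t)" for t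
      using motion reduced_motion_iff_soft_solution[OF assms(1) a] by blast+
  qed (use init in simp)
  then show ?thesis by simp
qed

text \<open>The softening radius is half of the lower bound \<open>\<omega>\<^sup>2 / 2\<close> for \<open>r\<close> in the Hill region, so a solution
of the softened equations that starts there with energy \<open>h\<close> never notices the softening.\<close>
lemma soft_solution_is_reduced_motion:
  assumes "\<beta> > -1" "\<omega> \<noteq> 0" "h < 0"
    and a: "a = \<omega>\<^sup>2 / 4"
    and sol: "\<And>t. ((\<lambda>t. (r t, z t, u t, v t)) has_vector_derivative
      soft_field a \<beta> \<omega> (r t, z t, u t, v t)) (at t)"
    and "r 0 > 0" "reduced_H \<beta> \<omega> ((r 0, z 0), (u 0, v 0)) = h"
  shows "reduced_motion \<beta> \<omega> r z u v"
proof -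
  have "a > 0" "a < \<omega>\<^sup>2 / 2" using \<open>\<omega> \<noteq> 0\<close> by (simp_all add: a)
  note bound = Hill_region_bounds(1)[OF \<open>\<beta> > -1\<close> _ \<open>h < 0\<close>]
  have "continuous_on UNIV (\<lambda>t. (r t, z t, u t, v t))"
    using sol by (intro continuous_at_imp_continuous_on ballI has_vector_derivative_continuous)
  from continuous_on_fst[OF this] have cont: "continuous_on UNIV r" by simp
  have "\<omega>\<^sup>2 / 2 \<le> r t" for t
  proof (rule barrier_from_conserved_quantity[OF cont \<open>a < \<omega>\<^sup>2 / 2\<close>])
    show "\<omega>\<^sup>2 / 2 \<le> r 0"
      using bound[of "r 0" \<omega> "z 0" "u 0" "v 0"] assms by simp
    show "((\<lambda>t. reduced_H \<beta> \<omega> ((r t, z t), (u t, v t))) has_real_derivative 0) (at t)"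
      if "r t > a" for t
    proof -
      have "r t > 0" "r t \<ge> a" using that \<open>a > 0\<close> by auto
      then show ?thesis
        using sol[of t] unfolding soft_field_eq[OF \<open>\<beta> > -1\<close> \<open>a > 0\<close> \<open>r t \<ge> a\<close>] has_vector_derivative_quadruple
        by (intro energy_has_derivative_0[OF \<open>\<beta> > -1\<close>]) auto
    qed
    show "\<omega>\<^sup>2 / 2 \<le> r t"
      if "r t > a" and "reduced_H \<beta> \<omega> ((r t, z t), (u t, v t)) = reduced_H \<beta> \<omega> ((r 0, z 0), (u 0, v 0))"
      for t
      using that \<open>a > 0\<close> assms(7) by (intro bound[of "r t" \<omega> "z t" "u t" "v t"]) linarith+
  qed
  then have "a \<le> r t" for t using \<open>a < \<omega>\<^sup>2 / 2\<close> by (meson less_imp_le order_trans)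
  with sol show ?thesis
    using reduced_motion_iff_soft_solution[OF \<open>\<beta> > -1\<close> \<open>a > 0\<close>] by blast
qed

text \<open>The same softened field serves all initial values, as the softening radius depends on \<open>\<omega>\<close> only. Continuity in
parameter and time together follows from the uniform stability estimate and continuity in time.\<close>
theorem brake_motions_exist:
  fixes c d :: "real \<Rightarrow> real"
  assumes "\<beta> > -1" "\<omega> \<noteq> 0" "h < 0"
    and "continuous_on S c" "continuous_on S d"
    and "\<And>s. s \<in> S \<Longrightarrow> c s > 0 \<and> reduced_V \<beta> \<omega> (c s) (d s) = h"
  shows "\<exists>r z u v :: real \<Rightarrow> real \<Rightarrow> real.
    (\<forall>s\<in>S. reduced_motion \<beta> \<omega> (r s) (z s) (u s) (v s) \<and>
       r s 0 = c s \<and> z s 0 = d s \<and> u s 0 = 0 \<and> v s 0 = 0) \<and>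
    continuous_on (S \<times> UNIV) (\<lambda>(s, t). z s t) \<and> continuous_on (S \<times> UNIV) (\<lambda>(s, t). u s t)"
proof -
  define a where "a = \<omega>\<^sup>2 / 4"
  have "a > 0" using \<open>\<omega> \<noteq> 0\<close> by (simp add: a_def)
  then obtain L where L: "L-lipschitz_on UNIV (soft_field a \<beta> \<omega>)"
    using lipschitz_soft_field by blast
  define x0 :: "real \<Rightarrow> real \<times> real \<times> real \<times> real" where "x0 s = (c s, d s, 0, 0)" for s
  have cont_x0: "continuous_on S x0"
    unfolding x0_def by (intro continuous_intros assms)
  obtain X where X: "\<And>s. X s 0 = x0 s"
    "\<And>s t. (X s has_vector_derivative soft_field a \<beta> \<omega> (X s t)) (at t)"
  proof -
    have "\<forall>s. \<exists>X. X 0 = x0 s \<and> (\<forall>t. (X has_vector_derivative soft_field a \<beta> \<omega> (X t)) (at t))"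
      using lipschitz_ode_exists[OF L] by blast
    from choice[OF this] show ?thesis using that by blast
  qed
  have stab: "norm (X s t - X s' t) \<le> exp (L * \<bar>t\<bar>) * norm (x0 s - x0 s')" for s s' t
    using lipschitz_ode_stability[OF L X(2) X(2), of s t s'] by (simp add: X(1))
  have cont_X: "continuous_on (S \<times> UNIV) (\<lambda>(s, t). X s t)"
    unfolding continuous_on_def
  proof clarify
    fix s t :: real assume "s \<in> S"
    let ?F = "at (s, t) within S \<times> UNIV"
    have tf: "(fst \<longlongrightarrow> s) ?F" "(snd \<longlongrightarrow> t) ?F"
      by (auto intro!: tendsto_eq_intros)
    have "((\<lambda>p. x0 (fst p)) \<longlongrightarrow> x0 s) ?F"
      by (rule continuous_on_tendsto_compose[OF cont_x0 tf(1) \<open>s \<in> S\<close>])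
         (auto simp: eventually_at_filter intro!: always_eventually)
    then have "((\<lambda>p. exp (L * \<bar>snd p\<bar>) * norm (x0 (fst p) - x0 s)) \<longlongrightarrow> exp (L * \<bar>t\<bar>) * norm (x0 s - x0 s)) ?F"
      by (intro tendsto_intros tf)
    then have "((\<lambda>p. exp (L * \<bar>snd p\<bar>) * norm (x0 (fst p) - x0 s)) \<longlongrightarrow> 0) ?F"
      by simp
    then have "((\<lambda>p. X (fst p) (snd p) - X s (snd p)) \<longlongrightarrow> 0) ?F"
      by (rule Lim_null_comparison[rotated]) (simp add: stab)
    moreover have "((\<lambda>p. X s (snd p)) \<longlongrightarrow> X s t) ?F"
      using has_vector_derivative_continuous[OF X(2)[of s t]] tf(2) by (rule isCont_tendsto_compose)
    ultimately have "((\<lambda>p. (X (fst p) (snd p) - X s (snd p)) + X s (snd p)) \<longlongrightarrow> 0 + X s t) ?F"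
      by (rule tendsto_add)
    then show "((\<lambda>(s, t). X s t) \<longlongrightarrow> X s t) ?F"
      by (simp add: case_prod_beta')
  qed
  define r z u v where "r s t = fst (X s t)" and "z s t = fst (snd (X s t))"
    and "u s t = fst (snd (snd (X s t)))" and "v s t = snd (snd (snd (X s t)))" for s t
  have X_eq: "X s = (\<lambda>t. (r s t, z s t, u s t, v s t))" for s
    by (simp add: r_def z_def u_def v_def)
  have "reduced_motion \<beta> \<omega> (r s) (z s) (u s) (v s) \<and>
       r s 0 = c s \<and> z s 0 = d s \<and> u s 0 = 0 \<and> v s 0 = 0" if "s \<in> S" for s
  proof -
    have init: "r s 0 = c s" "z s 0 = d s" "u s 0 = 0" "v s 0 = 0"
      by (simp_all add: r_def z_def u_def v_def X x0_def)
    have "reduced_motion \<beta> \<omega> (r s) (z s) (u s) (v s)"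
      using X(2)[of s] assms(6)[OF that] init
      by (intro soft_solution_is_reduced_motion[OF assms(1-3) a_def]) (auto simp: X_eq)
    with init show ?thesis by simp
  qed
  moreover have "continuous_on (S \<times> UNIV) (\<lambda>(s, t). z s t)" "continuous_on (S \<times> UNIV) (\<lambda>(s, t). u s t)"
    using cont_X unfolding z_def u_def case_prod_beta' by (auto intro!: continuous_intros)
  ultimately show ?thesis by blast
qed

lemma reduced_motion_shift:
  assumes "reduced_motion \<beta> \<omega> r z u v"
  shows "reduced_motion \<beta> \<omega> (\<lambda>t. r (c + t)) (\<lambda>t. z (c + t)) (\<lambda>t. u (c + t)) (\<lambda>t. v (c + t))"
  using assms unfolding reduced_motion_def by (simp add: add.commute[of c] flip: DERIV_shift)

lemma DERIV_reverse_time: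
  "(f has_real_derivative D) (at (c - t)) \<Longrightarrow> ((\<lambda>t. f (c - t)) has_real_derivative - D) (at t)"
  using has_vector_derivative_reverse_time[of f D c t]
  by (simp add: has_real_derivative_iff_has_vector_derivative)

lemma reduced_motion_reverse:
  assumes "reduced_motion \<beta> \<omega> r z u v"
  shows "reduced_motion \<beta> \<omega> (\<lambda>t. r (c - t)) (\<lambda>t. z (c - t)) (\<lambda>t. - u (c - t)) (\<lambda>t. - v (c - t))"
proof -
  have m: "r t > 0" "(r has_real_derivative u t) (at t)" "(z has_real_derivative v t) (at t)"
    "(u has_real_derivative \<omega>\<^sup>2 / r t ^ 3 - r t / eff_dist \<beta> (r t) (z t) ^ 3) (at t)"
    "(v has_real_derivative - ((1 + \<beta>) * z t / eff_dist \<beta> (r t) (z t) ^ 3)) (at t)" for t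
    using assms by (auto simp: reduced_motion_def)
  show ?thesis
    unfolding reduced_motion_def
    using DERIV_reverse_time[OF m(2)] DERIV_reverse_time[OF m(3)]
      DERIV_minus[OF DERIV_reverse_time[OF m(4)]] DERIV_minus[OF DERIV_reverse_time[OF m(5)]] m(1)
    by simp
qed

lemma reduced_motion_reflect:
  assumes "reduced_motion \<beta> \<omega> r z u v"
  shows "reduced_motion \<beta> \<omega> r (\<lambda>t. - z t) u (\<lambda>t. - v t)"
  using assms unfolding reduced_motion_def eff_dist_def
  by (auto intro!: derivative_eq_intros)

text \<open>At a brake instant time reversal fixes the state, so the motion is even. At a perpendicular crossing
of \<open>z = 0\<close> the composition of time reversal and the reflection of \<open>z\<close> fixes the state. Together these
symmetries give \<open>r (2 * T + t) = r t\<close> and \<open>z (2 * T + t) = - z t\<close>, and so the period \<open>4 * T\<close>.\<close>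
theorem brake_motion_periodic:
  assumes "\<beta> > -1" "\<omega> \<noteq> 0" and neg: "reduced_H \<beta> \<omega> ((r 0, z 0), (u 0, v 0)) < 0"
    and motion: "reduced_motion \<beta> \<omega> r z u v"
    and brake: "u 0 = 0" "v 0 = 0" and perp: "z T = 0" "u T = 0"
  shows "r (t + 4 * T) = r t \<and> z (t + 4 * T) = z t \<and> u (t + 4 * T) = u t \<and> v (t + 4 * T) = v t"
proof -
  have even: "r t = r (0 - t) \<and> z t = z (0 - t) \<and> u t = - u (0 - t) \<and> v t = - v (0 - t)" for t
    by (rule reduced_motion_unique[OF assms(1,2) neg motion reduced_motion_reverse[OF motion]])
       (simp_all add: brake)
  have neg_T: "reduced_H \<beta> \<omega> ((r (T + 0), z (T + 0)), (u (T + 0), v (T + 0))) < 0"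
    using reduced_motion_energy[OF assms(1) motion, of T] neg by simp
  have sym: "r (T + t) = r (T - t) \<and> z (T + t) = - z (T - t) \<and>
      u (T + t) = - u (T - t) \<and> v (T + t) = - (- v (T - t))" for t
    by (rule reduced_motion_unique[OF assms(1,2) neg_T reduced_motion_shift[OF motion]
          reduced_motion_reflect[OF reduced_motion_reverse[OF motion]]])
       (simp_all add: perp)
  have half: "r (2 * T + t) = r t \<and> z (2 * T + t) = - z t \<and> u (2 * T + t) = u t \<and> v (2 * T + t) = - v t" for t
  proof -
    have "T + (T + t) = 2 * T + t" "T - (T + t) = 0 - t" by simp_all
    with sym[of "T + t"] even[of t] show ?thesis by auto
  qed
  show ?thesis
    using half[of t] half[of "2 * T + t"] by (simp add: algebra_simps)
qed

section \<open>The first quarter turn of a brake motion\<close>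

lemma angle_exists:
  assumes "reduced_motion \<beta> \<omega> r z u v"
  shows "\<exists>\<theta>. \<theta> 0 = 0 \<and> (\<forall>t. (\<theta> has_real_derivative \<omega> / (r t)\<^sup>2) (at t))"
proof -
  have "isCont (\<lambda>t. \<omega> / (r t)\<^sup>2) t" for t
    using assms unfolding reduced_motion_def
    by (intro continuous_intros DERIV_isCont[of r "u t"]) (auto simp: less_imp_neq[symmetric])
  then obtain F where "\<And>t. (F has_real_derivative \<omega> / (r t)\<^sup>2) (at t)"
    using einterval_antiderivative[of "-\<infinity>" "\<infinity>" "\<lambda>t. \<omega> / (r t)\<^sup>2"]
    by (auto simp: has_real_derivative_iff_has_vector_derivative)
  then show ?thesis
    by (intro exI[of _ "\<lambda>t. F t - F 0"]) (auto intro!: derivative_eq_intros)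
qed

locale brake_motion =
  fixes \<beta> \<omega> h :: real and r z u v \<theta> :: "real \<Rightarrow> real"
  assumes \<beta>: "\<beta> > 0" and \<omega>: "\<omega> > 0" and h: "h < 0"
    and motion: "reduced_motion \<beta> \<omega> r z u v"
    and energy: "reduced_H \<beta> \<omega> ((r 0, z 0), (u 0, v 0)) = h"
    and brake: "u 0 = 0" "v 0 = 0"
    and z0: "z 0 > 0"
    and \<theta>0: "\<theta> 0 = 0" and \<theta>': "\<And>t. (\<theta> has_real_derivative \<omega> / (r t)\<^sup>2) (at t)"
begin

definition \<rho> :: "real \<Rightarrow> real" where "\<rho> t = eff_dist \<beta> (r t) (z t)"

lemma r_pos: "r t > 0"
  and r': "(r has_real_derivative u t) (at t)"
  and z': "(z has_real_derivative v t) (at t)"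
  and u': "(u has_real_derivative \<omega>\<^sup>2 / r t ^ 3 - r t / \<rho> t ^ 3) (at t)"
  and v': "(v has_real_derivative - ((1 + \<beta>) * z t / \<rho> t ^ 3)) (at t)"
  using motion by (auto simp: reduced_motion_def \<rho>_def)

lemma r_ge: "\<omega>\<^sup>2 / 2 \<le> r t" and \<rho>_le: "\<rho> t \<le> - 1 / h" and r_le_\<rho>: "r t \<le> \<rho> t"
  using reduced_motion_bounds[OF _ motion h energy] eff_dist_ge[OF _ r_pos[of t], of \<beta> "z t"] \<beta>
  by (auto simp: \<rho>_def)

lemma \<rho>_pos: "\<rho> t > 0"
  using r_pos[of t] r_le_\<rho>[of t] by linarith

lemma \<rho>_sq: "(\<rho> t)\<^sup>2 = (r t)\<^sup>2 + (1 + \<beta>) * (z t)\<^sup>2"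
  using \<beta> by (simp add: \<rho>_def eff_dist_def)

lemma continuous: "continuous_on S z" "continuous_on S v" "continuous_on S \<theta>"
  using z' v' \<theta>' by (auto intro!: continuous_at_imp_continuous_on DERIV_isCont)

lemma angle_mono: "s \<le> t \<Longrightarrow> \<theta> s \<le> \<theta> t"
  by (rule DERIV_nonneg_imp_nondecreasing) (use \<theta>' \<omega> in force)+

lemma angle_ge:
  assumes "t \<ge> 0"
  shows "\<omega> * h\<^sup>2 * t \<le> \<theta> t"
proof -
  have "\<theta> 0 - \<omega> * h\<^sup>2 * 0 \<le> \<theta> t - \<omega> * h\<^sup>2 * t"
  proof (rule DERIV_nonneg_imp_nondecreasing[OF assms, of "\<lambda>t. \<theta> t - \<omega> * h\<^sup>2 * t"])
    fix s
    have "r s \<le> - 1 / h" using r_le_\<rho>[of s] \<rho>_le[of s] by linarith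
    then have "r s * (- h) \<le> 1" using h by (simp add: field_simps)
    then have "(r s * (- h))\<^sup>2 \<le> 1"
      using r_pos[of s] h by (simp add: power_le_one_iff mult_nonneg_nonpos abs_square_le_1)
    then have "h\<^sup>2 \<le> 1 / (r s)\<^sup>2"
      using r_pos[of s] by (simp add: field_simps power_mult_distrib)
    from mult_left_mono[OF this, of \<omega>]
    have "0 \<le> \<omega> / (r s)\<^sup>2 - \<omega> * h\<^sup>2" using \<omega> by simp
    moreover have "((\<lambda>t. \<theta> t - \<omega> * h\<^sup>2 * t) has_real_derivative \<omega> / (r s)\<^sup>2 - \<omega> * h\<^sup>2) (at s)"
      by (auto intro!: derivative_eq_intros \<theta>')
    ultimately show "\<exists>y. ((\<lambda>t. \<theta> t - \<omega> * h\<^sup>2 * t) has_real_derivative y) (at s) \<and> 0 \<le> y"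
      by blast
  qed
  then show ?thesis by (simp add: \<theta>0)
qed

lemma quarter_turn: "\<exists>b>0. \<theta> b = pi / 2"
proof -
  define b where "b = pi / (2 * (\<omega> * h\<^sup>2))"
  have b: "b > 0" using \<omega> h by (simp add: b_def)
  have "\<theta> b \<ge> pi / 2"
    using angle_ge[of b] b \<omega> h by (simp add: b_def)
  then obtain c where "0 \<le> c" "\<theta> c = pi / 2"
    using IVT'[of \<theta> 0 "pi / 2" b] b continuous \<theta>0 by auto
  then show ?thesis
    using \<theta>0 by (intro exI[of _ c]) (cases "c = 0", auto)
qed

text \<open>The Wronskian of \<open>z\<close> and the Cartesian coordinate \<open>x = r * cos \<theta>\<close>, whose velocity is
\<open>u * cos \<theta> - \<omega> * sin \<theta> / r\<close>. The attractions of \<open>z\<close> and \<open>x\<close> to \<open>0\<close>, relative to \<open>z\<close> and \<open>x\<close>,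
differ by \<open>\<beta> / \<rho> ^ 3\<close>.\<close>
lemma wronskian_has_derivative:
  "((\<lambda>t. v t * (r t * cos (\<theta> t)) - z t * (u t * cos (\<theta> t) - \<omega> * sin (\<theta> t) / r t))
    has_real_derivative - (\<beta> * z t * r t * cos (\<theta> t) / \<rho> t ^ 3)) (at t)"
proof -
  have "r t \<noteq> 0" "\<rho> t ^ 3 \<noteq> 0" using r_pos[of t] \<rho>_pos[of t] by auto
  define k where "k = 1 / \<rho> t ^ 3"
  define j where "j = 1 / r t"
  have k: "x / \<rho> t ^ 3 = x * k" for x by (simp add: k_def)
  have j: "x / r t = x * j" "x / (r t)\<^sup>2 = x * j\<^sup>2" "x / (r t) ^ 3 = x * j ^ 3" for x
    by (simp_all add: j_def power_one_over field_simps)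
  have rj: "r t * j = 1" using \<open>r t \<noteq> 0\<close> by (simp add: j_def)
  \<comment> \<open>In terms of \<open>j\<close> and \<open>k\<close> the identity between the derivatives is polynomial.\<close>
  have dj: "((\<lambda>t. \<omega> * sin (\<theta> t) / r t) has_real_derivative
      \<omega> * (cos (\<theta> t) * (\<omega> * j\<^sup>2)) * j - \<omega> * sin (\<theta> t) * u t * j\<^sup>2) (at t)"
    by (rule derivative_eq_intros \<theta>' r' refl \<open>r t \<noteq> 0\<close>)+
       (use \<open>r t \<noteq> 0\<close> in \<open>simp add: j_def field_simps power2_eq_square\<close>)
  show ?thesis
    by (rule derivative_eq_intros dj \<theta>' r' z' u' v' refl)+
       (insert rj, unfold k j, algebra)
qed

text \<open>Sturm comparison: if \<open>z\<close> stayed positive up to the time \<open>b\<close> at which \<open>\<theta> = pi / 2\<close>, the Wronskian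
would be nonincreasing on \<open>[0, b]\<close> with initial value \<open>0\<close>; but at time \<open>b\<close> it equals \<open>z * \<omega> / r > 0\<close>.\<close>
lemma first_zero_before_quarter_turn: "\<exists>T. first_zero z T \<and> \<theta> T \<le> pi / 2"
proof -
  obtain b where b: "b > 0" "\<theta> b = pi / 2" using quarter_turn by blast
  have "\<exists>t\<in>{0..b}. z t \<le> 0"
  proof (rule ccontr)
    assume "\<not> (\<exists>t\<in>{0..b}. z t \<le> 0)"
    then have pos: "z t > 0" if "t \<in> {0..b}" for t using that by force
    define W where "W t = v t * (r t * cos (\<theta> t)) - z t * (u t * cos (\<theta> t) - \<omega> * sin (\<theta> t) / r t)" for t
    have "W b \<le> W 0"
    proof (rule DERIV_nonpos_imp_nonincreasing[of 0 b W])
      fix t assume t: "0 \<le> t" "t \<le> b"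
      have "0 \<le> \<theta> t" "\<theta> t \<le> pi / 2" using angle_mono[of 0 t] angle_mono[of t b] t \<theta>0 b by auto
      then have "cos (\<theta> t) \<ge> 0" by (intro cos_ge_zero) auto
      then have "\<beta> * z t * r t * cos (\<theta> t) / \<rho> t ^ 3 \<ge> 0"
        using pos[of t] t \<beta> r_pos[of t] \<rho>_pos[of t] by simp
      then show "\<exists>y. (W has_real_derivative y) (at t) \<and> y \<le> 0"
        unfolding W_def using wronskian_has_derivative[of t] by force
    qed (use b in simp)
    moreover have "W b > 0" using pos[of b] b(1) \<omega> r_pos[of b] by (simp add: W_def b(2))
    moreover have "W 0 = 0" by (simp add: W_def brake \<theta>0)
    ultimately show False by simp
  qed
  then obtain t where t: "t \<in> {0..b}" "z t \<le> 0" by blast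
  then obtain T where "T \<le> t" "first_zero z T"
    using first_zero_exists[of t z] continuous z0 by auto
  then show ?thesis using angle_mono[of T b] t b by auto
qed

context
  fixes T assumes T: "first_zero z T"
begin

lemma T_pos: "T > 0" and z_T: "z T = 0" and z_pos: "t \<in> {0..<T} \<Longrightarrow> z t > 0"
  using T by (auto simp: first_zero_def)

lemma v_neg:
  assumes "t \<in> {0<..T}"
  shows "v t < 0"
proof -
  have "v t < v 0"
  proof (rule DERIV_neg_imp_decreasing_open[of 0 t v])
    fix s assume "0 < s" "s < t"
    then have "(1 + \<beta>) * z s / \<rho> s ^ 3 > 0"
      using z_pos[of s] \<rho>_pos[of s] \<beta> assms by simp
    then show "\<exists>y. (v has_real_derivative y) (at s) \<and> y < 0"
      using v'[of s] by force
  qed (use assms continuous in auto)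
  then show ?thesis by (simp add: brake)
qed

lemma z_le:
  assumes "t \<in> {0..T}"
  shows "z t \<le> z 0"
proof (rule DERIV_nonpos_imp_nonincreasing[of 0 t z])
  fix s assume "0 \<le> s" "s \<le> t"
  then have "v s \<le> 0" using v_neg[of s] assms brake by (cases "s = 0") auto
  then show "\<exists>y. (z has_real_derivative y) (at s) \<and> y \<le> 0"
    using z'[of s] by blast
qed (use assms in auto)

lemma z_nonneg: "t \<in> {0..T} \<Longrightarrow> z t \<ge> 0"
  using z_pos[of t] z_T by (cases "t = T") auto

lemma crosses_downward:
  assumes "e > 0"
  shows "\<exists>t\<in>{T<..<T + e}. z t < 0"
proof -
  obtain d where d: "d > 0" "\<And>x. 0 < x \<Longrightarrow> x < d \<Longrightarrow> z (T + x) < z T"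
    using DERIV_neg_dec_right[OF z'[of T]] v_neg[of T] T_pos by auto
  define x where "x = min d e / 2"
  have "0 < x" "x < d" "x < e" using d(1) assms by (auto simp: x_def)
  then show ?thesis using d(2)[of x] z_T by (intro bexI[of _ "T + x"]) auto
qed

text \<open>A lower bound for the time of the first zero that does not depend on the size of \<open>z 0\<close>: until
then the acceleration of \<open>z\<close> is at most \<open>C * z 0\<close> in absolute value, so \<open>z t \<ge> z 0 * (1 - C * t\<^sup>2 / 2)\<close>.\<close>
lemma zero_time_ge: "2 / ((1 + \<beta>) / (\<omega>\<^sup>2 / 2) ^ 3) \<le> T\<^sup>2"
proof -
  define C where "C = (1 + \<beta>) / (\<omega>\<^sup>2 / 2) ^ 3"
  have C: "C > 0" using \<beta> \<omega> by (simp add: C_def)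
  have bound: "(1 + \<beta>) * z t / \<rho> t ^ 3 \<le> C * z 0" if "t \<in> {0..T}" for t
  proof -
    have "\<omega>\<^sup>2 / 2 \<le> \<rho> t" using r_ge[of t] r_le_\<rho>[of t] by linarith
    then have "(\<omega>\<^sup>2 / 2) ^ 3 \<le> \<rho> t ^ 3" by (intro power_mono) auto
    moreover have "(1 + \<beta>) * z t \<le> (1 + \<beta>) * z 0"
      using z_le[OF that] \<beta> by (intro mult_left_mono) auto
    ultimately have "(1 + \<beta>) * z t / \<rho> t ^ 3 \<le> (1 + \<beta>) * z 0 / (\<omega>\<^sup>2 / 2) ^ 3"
      using \<beta> z0 \<omega> by (intro frac_le) auto
    then show ?thesis by (simp add: C_def)
  qed
  have v_ge: "v t + C * z 0 * t \<ge> 0" if "t \<in> {0..T}" for t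
  proof -
    have "v 0 + C * z 0 * 0 \<le> v t + C * z 0 * t"
    proof (rule DERIV_nonneg_imp_nondecreasing[of 0 t "\<lambda>t. v t + C * z 0 * t"])
      fix s assume "0 \<le> s" "s \<le> t"
      then have "0 \<le> - ((1 + \<beta>) * z s / \<rho> s ^ 3) + C * z 0" using bound[of s] that by simp
      moreover have "((\<lambda>t. v t + C * z 0 * t) has_real_derivative
          - ((1 + \<beta>) * z s / \<rho> s ^ 3) + C * z 0) (at s)"
        by (rule derivative_eq_intros v' refl)+ simp
      ultimately show "\<exists>y. ((\<lambda>t. v t + C * z 0 * t) has_real_derivative y) (at s) \<and> 0 \<le> y"
        by blast
    qed (use that in auto)
    then show ?thesis by (simp add: brake)
  qed
  have "z 0 + C * z 0 / 2 * 0\<^sup>2 \<le> z T + C * z 0 / 2 * T\<^sup>2"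
  proof (rule DERIV_nonneg_imp_nondecreasing[of 0 T "\<lambda>t. z t + C * z 0 / 2 * t\<^sup>2"])
    fix s assume "0 \<le> s" "s \<le> T"
    then have "0 \<le> v s + C * z 0 * s" using v_ge[of s] by simp
    moreover have "((\<lambda>t. z t + C * z 0 / 2 * t\<^sup>2) has_real_derivative v s + C * z 0 * s) (at s)"
      by (rule derivative_eq_intros z' refl)+ simp
    ultimately show "\<exists>y. ((\<lambda>t. z t + C * z 0 / 2 * t\<^sup>2) has_real_derivative y) (at s) \<and> 0 \<le> y"
      by blast
  qed (use T_pos in simp)
  then have "z 0 * 1 \<le> z 0 * (C / 2 * T\<^sup>2)" by (simp add: z_T mult.commute mult.left_commute)
  then have "1 \<le> C / 2 * T\<^sup>2" using z0 by (simp only: mult_le_cancel_left_pos)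
  then show ?thesis using C unfolding C_def[symmetric] by (simp add: field_simps)
qed

end

text \<open>The excess of the planar Kepler attraction \<open>1 / r\<^sup>2\<close> over the actual radial attraction; it drives
the eccentricity vector.\<close>
definition defect :: "real \<Rightarrow> real" where "defect t = 1 / (r t)\<^sup>2 - r t / \<rho> t ^ 3"

lemma defect_nonneg: "0 \<le> defect t"
proof -
  have "r t * (r t)\<^sup>2 \<le> \<rho> t ^ 3"
    using power_mono[OF r_le_\<rho>[of t], of 3] r_pos[of t] by (simp add: power2_eq_square power3_eq_cube)
  then show ?thesis
    using r_pos[of t] \<rho>_pos[of t] by (simp add: defect_def field_simps)
qed

text \<open>With \<open>q = r / \<rho>\<close> the defect is \<open>(1 - q ^ 3) / r\<^sup>2\<close>, and \<open>1 - q\<^sup>2\<close> equals \<open>(1 + \<beta>) * z\<^sup>2 / \<rho>\<^sup>2\<close>. So the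
defect is of second order in \<open>z\<close>.\<close>
lemma defect_le: "defect t \<le> 2 * (1 + \<beta>) * (z t)\<^sup>2 / (\<omega>\<^sup>2 / 2) ^ 4"
proof -
  define q where "q = r t / \<rho> t"
  have q: "0 \<le> q" "q \<le> 1" using r_pos[of t] \<rho>_pos[of t] r_le_\<rho>[of t] by (auto simp: q_def)
  have "(1 - q\<^sup>2) * (r t)\<^sup>2 \<le> (1 - q\<^sup>2) * (\<rho> t)\<^sup>2"
    using q r_le_\<rho>[of t] r_pos[of t] by (intro mult_left_mono power_mono) (auto simp: power_le_one)
  also have "\<dots> = (1 + \<beta>) * (z t)\<^sup>2"
  proof -
    have "q * \<rho> t = r t" using \<rho>_pos[of t] by (simp add: q_def)
    with \<rho>_sq[of t] show ?thesis by algebra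
  qed
  finally have q2: "(1 - q\<^sup>2) * (r t)\<^sup>2 \<le> (1 + \<beta>) * (z t)\<^sup>2" .
  have "1 - q ^ 3 \<le> 1 - q ^ 4" using q by (simp add: power_decreasing)
  also have "\<dots> \<le> 2 * (1 - q\<^sup>2)"
  proof -
    have "0 \<le> (1 - q\<^sup>2)\<^sup>2" by simp
    then show ?thesis by (simp add: power2_eq_square algebra_simps power4_eq_xxxx)
  qed
  finally have q3: "1 - q ^ 3 \<le> 2 * (1 - q\<^sup>2)" .
  have "defect t * (r t) ^ 4 = (1 - q ^ 3) * (r t)\<^sup>2"
    using r_pos[of t] \<rho>_pos[of t]
    by (simp add: defect_def q_def power_divide field_simps power2_eq_square power3_eq_cube power4_eq_xxxx)
  also have "\<dots> \<le> 2 * (1 - q\<^sup>2) * (r t)\<^sup>2" using q3 by (intro mult_right_mono) auto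
  also have "\<dots> \<le> 2 * (1 + \<beta>) * (z t)\<^sup>2"
    using mult_left_mono[OF q2, of 2] by (simp only: mult.assoc)
  finally have "defect t * (r t) ^ 4 \<le> 2 * (1 + \<beta>) * (z t)\<^sup>2" .
  moreover have "defect t * (\<omega>\<^sup>2 / 2) ^ 4 \<le> defect t * (r t) ^ 4"
    using r_ge[of t] by (intro mult_left_mono power_mono defect_nonneg) auto
  ultimately show ?thesis using \<omega> by (simp add: pos_le_divide_eq)
qed

text \<open>The eccentricity (Laplace-Runge-Lenz) vector of the planar Kepler problem, evaluated at the
projection of the motion to the equatorial plane: \<open>e\<^sub>x = \<omega> * y' - x / r\<close> and \<open>e\<^sub>y = - \<omega> * x' - y / r\<close>
for \<open>x = r * cos \<theta>\<close> and \<open>y = r * sin \<theta>\<close>.\<close>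
definition ecc_x :: "real \<Rightarrow> real" where
  "ecc_x t = \<omega> * (u t * sin (\<theta> t) + \<omega> * cos (\<theta> t) / r t) - cos (\<theta> t)"

definition ecc_y :: "real \<Rightarrow> real" where
  "ecc_y t = - (\<omega> * (u t * cos (\<theta> t) - \<omega> * sin (\<theta> t) / r t)) - sin (\<theta> t)"

lemma ecc_x': "(ecc_x has_real_derivative \<omega> * sin (\<theta> t) * defect t) (at t)"
  and ecc_y': "(ecc_y has_real_derivative - (\<omega> * cos (\<theta> t) * defect t)) (at t)"
proof -
  have "r t \<noteq> 0" using r_pos[of t] by auto
  define k where "k = 1 / \<rho> t ^ 3"
  define j where "j = 1 / r t"
  have k: "x / \<rho> t ^ 3 = x * k" for x by (simp add: k_def)
  have j: "x / r t = x * j" "x / (r t)\<^sup>2 = x * j\<^sup>2" "x / (r t) ^ 3 = x * j ^ 3" for x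
    by (simp_all add: j_def power_one_over field_simps)
  have dj_sin: "((\<lambda>t. \<omega> * sin (\<theta> t) / r t) has_real_derivative
      \<omega> * (cos (\<theta> t) * (\<omega> * j\<^sup>2)) * j - \<omega> * sin (\<theta> t) * u t * j\<^sup>2) (at t)"
    by (rule derivative_eq_intros \<theta>' r' refl \<open>r t \<noteq> 0\<close>)+
       (use \<open>r t \<noteq> 0\<close> in \<open>simp add: j_def field_simps power2_eq_square\<close>)
  have dj_cos: "((\<lambda>t. \<omega> * cos (\<theta> t) / r t) has_real_derivative
      - (\<omega> * (sin (\<theta> t) * (\<omega> * j\<^sup>2)) * j) - \<omega> * cos (\<theta> t) * u t * j\<^sup>2) (at t)"
    by (rule derivative_eq_intros \<theta>' r' refl \<open>r t \<noteq> 0\<close>)+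
       (use \<open>r t \<noteq> 0\<close> in \<open>simp add: j_def field_simps power2_eq_square\<close>)
  note dj = dj_sin dj_cos
  show "(ecc_x has_real_derivative \<omega> * sin (\<theta> t) * defect t) (at t)"
    unfolding ecc_x_def defect_def
    by (rule derivative_eq_intros dj \<theta>' u' refl)+ (unfold k j, algebra)
  show "(ecc_y has_real_derivative - (\<omega> * cos (\<theta> t) * defect t)) (at t)"
    unfolding ecc_y_def defect_def
    by (rule derivative_eq_intros dj \<theta>' u' refl)+ (unfold k j, algebra)
qed

lemma radial_velocity: "\<omega> * u t = sin (\<theta> t) * ecc_x t - cos (\<theta> t) * ecc_y t"
  unfolding ecc_x_def ecc_y_def using sin_cos_squared_add[of "\<theta> t"] by algebra

lemma ecc_0: "ecc_x 0 = \<omega>\<^sup>2 / r 0 - 1" "ecc_y 0 = 0"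
  by (simp_all add: ecc_x_def ecc_y_def \<theta>0 brake power2_eq_square)

lemma angle_first_quadrant:
  assumes "\<theta> T \<le> pi / 2" "t \<in> {0..T}"
  shows "0 \<le> \<theta> t" "\<theta> t \<le> pi / 2" "0 \<le> sin (\<theta> t)" "0 \<le> cos (\<theta> t)"
proof -
  show *: "0 \<le> \<theta> t" "\<theta> t \<le> pi / 2"
    using angle_mono[of 0 t] angle_mono[of t T] assms \<theta>0 by auto
  show "0 \<le> sin (\<theta> t)" "0 \<le> cos (\<theta> t)"
    using * by (auto intro!: sin_ge_zero cos_ge_zero)
qed

text \<open>At the start \<open>e\<^sub>x \<ge> 0 = e\<^sub>y\<close>, and in the first quadrant \<open>e\<^sub>x\<close> can only grow and \<open>e\<^sub>y\<close> only shrink;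
so neither term of \<open>sin \<theta> * e\<^sub>x - cos \<theta> * e\<^sub>y\<close> becomes negative.\<close>
lemma outward_if_started_inside:
  assumes "r 0 \<le> \<omega>\<^sup>2" "T \<ge> 0" "\<theta> T \<le> pi / 2"
  shows "u T \<ge> 0"
proof -
  have "ecc_x 0 \<le> ecc_x T"
  proof (rule DERIV_nonneg_imp_nondecreasing[OF \<open>T \<ge> 0\<close>, of ecc_x])
    fix t assume "0 \<le> t" "t \<le> T"
    then have "0 \<le> \<omega> * sin (\<theta> t) * defect t"
      using angle_first_quadrant(3)[OF assms(3), of t] defect_nonneg[of t] \<omega> by simp
    then show "\<exists>y. (ecc_x has_real_derivative y) (at t) \<and> 0 \<le> y" using ecc_x'[of t] by blast
  qed
  moreover have "ecc_y T \<le> ecc_y 0"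
  proof (rule DERIV_nonpos_imp_nonincreasing[OF \<open>T \<ge> 0\<close>, of ecc_y])
    fix t assume "0 \<le> t" "t \<le> T"
    then have "- (\<omega> * cos (\<theta> t) * defect t) \<le> 0"
      using angle_first_quadrant(4)[OF assms(3), of t] defect_nonneg[of t] \<omega> by simp
    then show "\<exists>y. (ecc_y has_real_derivative y) (at t) \<and> y \<le> 0" using ecc_y'[of t] by blast
  qed
  moreover have "ecc_x 0 \<ge> 0" using assms(1) r_pos[of 0] by (simp add: ecc_0)
  ultimately have "ecc_x T \<ge> 0" "ecc_y T \<le> 0" by (auto simp: ecc_0)
  then have "0 \<le> sin (\<theta> T) * ecc_x T" "cos (\<theta> T) * ecc_y T \<le> 0"
    using angle_first_quadrant(3,4)[OF assms(3), of T] \<open>T \<ge> 0\<close>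
    by (auto intro: mult_nonneg_nonneg mult_nonneg_nonpos)
  then have "\<omega> * u T \<ge> 0" using radial_velocity[of T] by linarith
  then show ?thesis using \<omega> by (simp add: zero_le_mult_iff)
qed

text \<open>Until \<open>T\<close> each component of the eccentricity vector changes by at most \<open>\<eta>\<close>, which is quadratic in
\<open>z 0\<close>, whereas \<open>e\<^sub>x \<le> - d\<close> at the start. The angle \<open>\<phi>\<close> is a lower bound for \<open>\<theta> T\<close> independent of
\<open>z 0\<close>. Hence \<open>sin \<theta> * e\<^sub>x - cos \<theta> * e\<^sub>y \<le> sin \<phi> * (\<eta> - d) + \<eta>\<close> at time \<open>T\<close>, and this is nonpositive
once \<open>\<eta>\<close> is small.\<close>
lemma inward_if_started_outside:
  fixes d :: real
  defines "\<phi> \<equiv> \<omega> * h\<^sup>2 * sqrt (2 / ((1 + \<beta>) / (\<omega>\<^sup>2 / 2) ^ 3))"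
    and "\<eta> \<equiv> \<omega> * (2 * (1 + \<beta>) * (z 0)\<^sup>2 / (\<omega>\<^sup>2 / 2) ^ 4) * (pi / (2 * (\<omega> * h\<^sup>2)))"
  assumes d: "\<omega>\<^sup>2 / r 0 - 1 \<le> - d" "0 \<le> d"
    and small: "2 * \<eta> \<le> sin (min \<phi> (pi / 2)) * d"
    and T: "first_zero z T" "\<theta> T \<le> pi / 2"
  shows "u T \<le> 0"
proof -
  define G where "G = 2 * (1 + \<beta>) * (z 0)\<^sup>2 / (\<omega>\<^sup>2 / 2) ^ 4"
  have G: "defect t \<le> G" if "t \<in> {0..T}" for t
  proof -
    have "(z t)\<^sup>2 \<le> (z 0)\<^sup>2"
      using z_le[OF T(1) that] z_nonneg[OF T(1) that] by (intro power_mono) auto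
    then have "2 * (1 + \<beta>) * (z t)\<^sup>2 / (\<omega>\<^sup>2 / 2) ^ 4 \<le> G"
      unfolding G_def using \<beta> by (intro divide_right_mono mult_left_mono) auto
    then show ?thesis using defect_le[of t] by linarith
  qed
  have G0: "G \<ge> 0" using \<beta> by (simp add: G_def)
  have "T > 0" using T_pos[OF T(1)] .
  have "\<omega> * h\<^sup>2 * T \<le> pi / 2" using angle_ge[of T] \<open>T > 0\<close> T(2) by simp
  then have "T \<le> pi / (2 * (\<omega> * h\<^sup>2))" using \<omega> h by (simp add: field_simps)
  then have \<eta>: "\<omega> * G * T \<le> \<eta>"
    unfolding \<eta>_def G_def[symmetric] using \<omega> G0 by (intro mult_left_mono) auto
  have ex: "ecc_x T - \<omega> * G * T \<le> ecc_x 0 - \<omega> * G * 0"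
  proof (rule DERIV_nonpos_imp_nonincreasing[of 0 T "\<lambda>t. ecc_x t - \<omega> * G * t"])
    fix t assume t: "0 \<le> t" "t \<le> T"
    have "sin (\<theta> t) * defect t \<le> 1 * G"
      using G[of t] t defect_nonneg[of t] angle_first_quadrant(3)[OF T(2), of t]
      by (intro mult_mono) auto
    then have "\<omega> * sin (\<theta> t) * defect t - \<omega> * G \<le> 0" using \<omega> by simp
    moreover have "((\<lambda>t. ecc_x t - \<omega> * G * t) has_real_derivative \<omega> * sin (\<theta> t) * defect t - \<omega> * G) (at t)"
      by (rule derivative_eq_intros ecc_x' refl)+ simp
    ultimately show "\<exists>y. ((\<lambda>t. ecc_x t - \<omega> * G * t) has_real_derivative y) (at t) \<and> y \<le> 0" by blast
  qed (use \<open>T > 0\<close> in simp)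
  have ey: "ecc_y 0 + \<omega> * G * 0 \<le> ecc_y T + \<omega> * G * T"
  proof (rule DERIV_nonneg_imp_nondecreasing[of 0 T "\<lambda>t. ecc_y t + \<omega> * G * t"])
    fix t assume t: "0 \<le> t" "t \<le> T"
    have "cos (\<theta> t) * defect t \<le> 1 * G"
      using G[of t] t defect_nonneg[of t] angle_first_quadrant(4)[OF T(2), of t]
      by (intro mult_mono) auto
    then have "0 \<le> - (\<omega> * cos (\<theta> t) * defect t) + \<omega> * G" using \<omega> by simp
    moreover have "((\<lambda>t. ecc_y t + \<omega> * G * t) has_real_derivative - (\<omega> * cos (\<theta> t) * defect t) + \<omega> * G) (at t)"
      by (rule derivative_eq_intros ecc_y' refl)+ simp
    ultimately show "\<exists>y. ((\<lambda>t. ecc_y t + \<omega> * G * t) has_real_derivative y) (at t) \<and> 0 \<le> y" by blast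
  qed (use \<open>T > 0\<close> in simp)
  have \<eta>0: "\<eta> \<ge> 0"
    using \<eta> G0 \<omega> \<open>T > 0\<close> by (meson less_imp_le mult_nonneg_nonneg order_trans)
  define k where "k = sin (min \<phi> (pi / 2))"
  have "sqrt (2 / ((1 + \<beta>) / (\<omega>\<^sup>2 / 2) ^ 3)) \<le> T"
    using zero_time_ge[OF T(1)] \<open>T > 0\<close> by (intro real_le_lsqrt) auto
  then have "\<phi> \<le> \<omega> * h\<^sup>2 * T"
    unfolding \<phi>_def using \<omega> by (intro mult_left_mono) auto
  also have "\<dots> \<le> \<theta> T" using angle_ge[of T] \<open>T > 0\<close> by simp
  finally have "\<phi> \<le> \<theta> T" .
  moreover have "\<phi> \<ge> 0" unfolding \<phi>_def using \<omega> \<beta> by simp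
  ultimately have k: "k \<le> sin (\<theta> T)"
    unfolding k_def using T(2) by (intro sin_monotone_2pi_le) auto
  have k1: "k \<le> 1" by (simp add: k_def)
  have "k * d \<le> 1 * d" using k1 d(2) by (rule mult_right_mono)
  then have neg: "\<eta> - d \<le> 0" using small \<eta>0 by (simp add: k_def)
  have "ecc_x T \<le> \<eta> - d" using ex \<eta> d(1) by (simp add: ecc_0)
  then have "sin (\<theta> T) * ecc_x T \<le> sin (\<theta> T) * (\<eta> - d)"
    using angle_first_quadrant(3)[OF T(2), of T] \<open>T > 0\<close> by (intro mult_left_mono) auto
  also have "\<dots> \<le> k * (\<eta> - d)" using k neg by (rule mult_right_mono_neg)
  also have "\<dots> = k * \<eta> - k * d" by (simp add: algebra_simps)
  also have "\<dots> \<le> \<eta> - 2 * \<eta>"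
    using small mult_right_mono[OF k1 \<eta>0] by (simp add: k_def)
  finally have "sin (\<theta> T) * ecc_x T \<le> - \<eta>" by simp
  moreover have "- (cos (\<theta> T) * ecc_y T) \<le> \<eta>"
  proof -
    have "- ecc_y T \<le> \<eta>" using ey \<eta> by (simp add: ecc_0)
    then have "cos (\<theta> T) * (- ecc_y T) \<le> cos (\<theta> T) * \<eta>"
      using angle_first_quadrant(4)[OF T(2), of T] \<open>T > 0\<close> by (intro mult_left_mono) auto
    also have "\<dots> \<le> 1 * \<eta>" using \<eta>0 by (intro mult_right_mono) auto
    finally show ?thesis by simp
  qed
  ultimately have "\<omega> * u T \<le> 0" using radial_velocity[of T] by linarith
  then show ?thesis using \<omega> by (simp add: mult_le_0_iff)
qed

end

section \<open>Hamilton's equations in coordinates\<close>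

lemma inverse_eff_dist_has_derivative:
  assumes "\<beta> > -1" "r > 0"
  shows "((\<lambda>s. 1 / eff_dist \<beta> (r + s) z) has_real_derivative - (r / eff_dist \<beta> r z ^ 3)) (at 0)"
    and "((\<lambda>s. 1 / eff_dist \<beta> r (z + s)) has_real_derivative - ((1 + \<beta>) * z / eff_dist \<beta> r z ^ 3)) (at 0)"
proof -
  define S where "S = r\<^sup>2 + (1 + \<beta>) * z\<^sup>2"
  have S: "S > 0" using assms by (simp add: S_def add_pos_nonneg)
  have e3: "eff_dist \<beta> r z ^ 3 = S * sqrt S"
    using S by (simp add: eff_dist_def S_def power3_eq_cube)
  have inv_sqrt: "((\<lambda>s. 1 / sqrt (f s)) has_real_derivative - (D / 2 / (S * sqrt S))) (at 0)"
    if f: "(f has_real_derivative D) (at 0)" "f 0 = S" for f D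
  proof -
    have "((\<lambda>s. sqrt (f s)) has_real_derivative inverse (sqrt S) / 2 * D) (at 0)"
      using DERIV_chain2[where f = sqrt and g = f and Da = "inverse (sqrt S) / 2", OF _ f(1)] DERIV_real_sqrt[OF S] f(2) by simp
    then have "((\<lambda>s. inverse (sqrt (f s))) has_real_derivative - (D / 2 / (S * sqrt S))) (at 0)"
      by (rule DERIV_inverse_fun[THEN DERIV_cong]) (use S f(2) in \<open>simp_all add: field_simps\<close>)
    then show ?thesis by (simp add: inverse_eq_divide)
  qed
  have "((\<lambda>s. (r + s)\<^sup>2 + (1 + \<beta>) * z\<^sup>2) has_real_derivative 2 * r) (at 0)"
    "((\<lambda>s. r\<^sup>2 + (1 + \<beta>) * (z + s)\<^sup>2) has_real_derivative 2 * ((1 + \<beta>) * z)) (at 0)"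
    by (auto intro!: derivative_eq_intros)
  from inv_sqrt[OF this(1)] inv_sqrt[OF this(2)]
  show "((\<lambda>s. 1 / eff_dist \<beta> (r + s) z) has_real_derivative - (r / eff_dist \<beta> r z ^ 3)) (at 0)"
    and "((\<lambda>s. 1 / eff_dist \<beta> r (z + s)) has_real_derivative - ((1 + \<beta>) * z / eff_dist \<beta> r z ^ 3)) (at 0)"
    unfolding e3 by (simp_all add: eff_dist_def S_def)
qed

lemma centrifugal_has_derivative:
  fixes \<omega> r :: real
  assumes "r > 0"
  shows "((\<lambda>s. \<omega>\<^sup>2 / (r + s)\<^sup>2) has_real_derivative - (2 * \<omega>\<^sup>2 / r ^ 3)) (at 0)"
  by (rule derivative_eq_intros refl)+
     (use assms in \<open>simp_all add: field_simps power2_eq_square power3_eq_cube\<close>)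

lemma kepler_H_partials:
  assumes "\<beta> > -1" "r > 0"
  shows "deriv (\<lambda>s. kepler_H \<beta> ((r + s, \<theta>, z), (u, \<omega>, v))) 0 = - (\<omega>\<^sup>2 / r ^ 3 - r / eff_dist \<beta> r z ^ 3)"
    and "deriv (\<lambda>s. kepler_H \<beta> ((r, \<theta> + s, z), (u, \<omega>, v))) 0 = 0"
    and "deriv (\<lambda>s. kepler_H \<beta> ((r, \<theta>, z + s), (u, \<omega>, v))) 0 = (1 + \<beta>) * z / eff_dist \<beta> r z ^ 3"
    and "deriv (\<lambda>s. kepler_H \<beta> ((r, \<theta>, z), (u + s, \<omega>, v))) 0 = u"
    and "deriv (\<lambda>s. kepler_H \<beta> ((r, \<theta>, z), (u, \<omega> + s, v))) 0 = \<omega> / r\<^sup>2"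
    and "deriv (\<lambda>s. kepler_H \<beta> ((r, \<theta>, z), (u, \<omega>, v + s))) 0 = v"
proof -
  have "r\<^sup>2 \<noteq> 0" using assms(2) by simp
  note derivs = inverse_eff_dist_has_derivative[OF assms] centrifugal_has_derivative[OF assms(2)]
    derivative_eq_intros refl this
  show "deriv (\<lambda>s. kepler_H \<beta> ((r + s, \<theta>, z), (u, \<omega>, v))) 0 = - (\<omega>\<^sup>2 / r ^ 3 - r / eff_dist \<beta> r z ^ 3)"
    unfolding kepler_H.simps eff_dist_def[symmetric]
    by (rule DERIV_imp_deriv, (rule derivs)+) simp_all
  show "deriv (\<lambda>s. kepler_H \<beta> ((r, \<theta> + s, z), (u, \<omega>, v))) 0 = 0"
    unfolding kepler_H.simps eff_dist_def[symmetric]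
    by (rule DERIV_imp_deriv, (rule derivs)+) simp_all
  show "deriv (\<lambda>s. kepler_H \<beta> ((r, \<theta>, z + s), (u, \<omega>, v))) 0 = (1 + \<beta>) * z / eff_dist \<beta> r z ^ 3"
    unfolding kepler_H.simps eff_dist_def[symmetric]
    by (rule DERIV_imp_deriv, (rule derivs)+) simp_all
  show "deriv (\<lambda>s. kepler_H \<beta> ((r, \<theta>, z), (u + s, \<omega>, v))) 0 = u"
    unfolding kepler_H.simps eff_dist_def[symmetric]
    by (rule DERIV_imp_deriv, (rule derivs)+) simp_all
  show "deriv (\<lambda>s. kepler_H \<beta> ((r, \<theta>, z), (u, \<omega> + s, v))) 0 = \<omega> / r\<^sup>2"
    unfolding kepler_H.simps eff_dist_def[symmetric]
    by (rule DERIV_imp_deriv, (rule derivs)+) (use assms(2) in \<open>simp_all add: field_simps power2_eq_square\<close>)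
  show "deriv (\<lambda>s. kepler_H \<beta> ((r, \<theta>, z), (u, \<omega>, v + s))) 0 = v"
    unfolding kepler_H.simps eff_dist_def[symmetric]
    by (rule DERIV_imp_deriv, (rule derivs)+) simp_all
qed

lemma reduced_H_eq:
  "reduced_H \<beta> \<omega> ((r, z), (u, v)) = 1 / 2 * (u\<^sup>2 + v\<^sup>2) + (1 / 2 * (\<omega>\<^sup>2 / r\<^sup>2) - 1 / eff_dist \<beta> r z)"
  by (simp add: reduced_V_def eff_dist_def)

lemma reduced_H_partials:
  assumes "\<beta> > -1" "r > 0"
  shows "deriv (\<lambda>s. reduced_H \<beta> \<omega> ((r + s, z), (u, v))) 0 = - (\<omega>\<^sup>2 / r ^ 3 - r / eff_dist \<beta> r z ^ 3)"
    and "deriv (\<lambda>s. reduced_H \<beta> \<omega> ((r, z + s), (u, v))) 0 = (1 + \<beta>) * z / eff_dist \<beta> r z ^ 3"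
    and "deriv (\<lambda>s. reduced_H \<beta> \<omega> ((r, z), (u + s, v))) 0 = u"
    and "deriv (\<lambda>s. reduced_H \<beta> \<omega> ((r, z), (u, v + s))) 0 = v"
  using assms(2) unfolding reduced_H_eq
  by - (rule DERIV_imp_deriv, (rule inverse_eff_dist_has_derivative[OF assms]
        centrifugal_has_derivative[OF assms(2)] derivative_eq_intros refl)+,
      simp_all; fail)+

lemma reduced_motion_imp_reduced_solution:
  assumes "\<beta> > -1" "reduced_motion \<beta> \<omega> r z u v"
  shows "reduced_solution \<beta> \<omega> (\<lambda>t. (r t, z t)) (\<lambda>t. (u t, v t))"
  using assms(2) reduced_H_partials[OF assms(1)]
  unfolding reduced_solution_def hamilton_solution_def reduced_motion_def
  by (auto simp: Basis_prod_def)

lemma reduced_motion_imp_kepler_solution: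
  assumes "\<beta> > -1" "reduced_motion \<beta> \<omega> r z u v"
    and "\<And>t. (\<theta> has_real_derivative \<omega> / (r t)\<^sup>2) (at t)"
  shows "kepler_solution \<beta> (\<lambda>t. (r t, \<theta> t, z t)) (\<lambda>t. (u t, \<omega>, v t))"
  using assms(2,3) kepler_H_partials[OF assms(1)]
  unfolding kepler_solution_def hamilton_solution_def reduced_motion_def
  by (auto simp: Basis_prod_def)

section \<open>Shooting from the boundary of the Hill region\<close>

text \<open>The boundary \<open>V = h\<close> of the Hill region is a graph over the \<open>r\<close>-axis: it is given by
\<open>\<rho> = 1 / (\<omega>\<^sup>2 / (2 * r\<^sup>2) - h)\<close>, to be solved for \<open>z\<close>.\<close>
definition Hill_height :: "real \<Rightarrow> real \<Rightarrow> real \<Rightarrow> real \<Rightarrow> real" where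
  "Hill_height \<beta> \<omega> h s = sqrt (((1 / (\<omega>\<^sup>2 / (2 * s\<^sup>2) - h))\<^sup>2 - s\<^sup>2) / (1 + \<beta>))"

text \<open>The aphelion distance of the planar Kepler orbit with energy \<open>h\<close> and angular momentum \<open>\<omega>\<close>.\<close>
definition Hill_radius :: "real \<Rightarrow> real \<Rightarrow> real" where
  "Hill_radius \<omega> h = (1 + sqrt (1 + 2 * h * \<omega>\<^sup>2)) / (- 2 * h)"

context
  fixes \<beta> \<omega> h :: real
  assumes \<beta>: "\<beta> > -1" and \<omega>: "\<omega> > 0" and h: "h < 0" "- (1 / (2 * \<omega>\<^sup>2)) < h"
begin

lemma discriminant: "0 < 1 + 2 * h * \<omega>\<^sup>2" "1 + 2 * h * \<omega>\<^sup>2 < 1"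
  using h \<omega> by (auto simp: field_simps mult_neg_pos)

lemma Hill_radius_greater: "\<omega>\<^sup>2 < Hill_radius \<omega> h"
proof -
  have "\<omega>\<^sup>2 * (- 2 * h) < 1" using discriminant by (simp add: mult_ac)
  also have "1 \<le> 1 + sqrt (1 + 2 * h * \<omega>\<^sup>2)" using discriminant by simp
  finally show ?thesis using h(1) unfolding Hill_radius_def by (simp only: pos_less_divide_eq)
qed

lemma inverse_Hill_dist_pos: "\<omega>\<^sup>2 / (2 * s\<^sup>2) - h > 0"
proof -
  have "0 \<le> \<omega>\<^sup>2 / (2 * s\<^sup>2)" by simp
  then show ?thesis using h(1) by linarith
qed

text \<open>Up to positive factors, \<open>1 - s * (\<omega>\<^sup>2 / (2 * s\<^sup>2) - h)\<close> is \<open>D\<^sup>2 - (2 * h * s + 1)\<^sup>2\<close>, where \<open>D\<close> is the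
eccentricity of the planar orbit. For \<open>s\<close> in the given range \<open>2 * h * s + 1\<close> runs from \<open>D\<^sup>2 < D\<close>
down to \<open>- D\<close>.\<close>
lemma Hill_boundary_gap:
  assumes "\<omega>\<^sup>2 \<le> s" "s \<le> Hill_radius \<omega> h"
  shows "s \<le> 1 / (\<omega>\<^sup>2 / (2 * s\<^sup>2) - h)"
    and "s = 1 / (\<omega>\<^sup>2 / (2 * s\<^sup>2) - h) \<longleftrightarrow> s = Hill_radius \<omega> h"
proof -
  define D where "D = sqrt (1 + 2 * h * \<omega>\<^sup>2)"
  have D: "0 < D" "D < 1" "D\<^sup>2 = 1 + 2 * h * \<omega>\<^sup>2"
    using discriminant by (auto simp: D_def)
  have "s > 0" using assms(1) \<omega> by (meson less_le_trans zero_less_power)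
  have "2 * h * s + 1 \<le> D\<^sup>2" using assms(1) h(1) unfolding D(3) by (simp add: mult_le_cancel_left)
  also have "D\<^sup>2 < D" using D(1,2) by (simp add: power2_eq_square)
  finally have upper: "2 * h * s + 1 < D" .
  have lower: "- D \<le> 2 * h * s + 1" "- D = 2 * h * s + 1 \<longleftrightarrow> s = Hill_radius \<omega> h"
    using assms(2) h(1) unfolding Hill_radius_def D_def[symmetric] by (auto simp: field_simps)
  define w where "w = \<omega>\<^sup>2 / (2 * s\<^sup>2) - h"
  define X where "X = \<omega>\<^sup>2 - 2 * h * s\<^sup>2 - 2 * s"
  have w: "w > 0" unfolding w_def by (rule inverse_Hill_dist_pos)
  have factor: "- 2 * h * X = (2 * h * s + 1 - D) * (2 * h * s + 1 + D)"
    using D(3) unfolding X_def by algebra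
  have gap: "1 - s * w = - X / (2 * s)"
    using \<open>s > 0\<close> by (simp add: w_def X_def field_simps power2_eq_square)
  have "(2 * h * s + 1 - D) * (2 * h * s + 1 + D) \<le> 0"
    using upper lower(1) by (intro mult_nonpos_nonneg) auto
  then have "X \<le> 0"
    unfolding factor[symmetric] using h(1) by (metis mult_pos_pos neg_0_less_iff_less
        mult_minus_left mult_pos_neg not_le zero_less_numeral)
  then have "0 \<le> - X / (2 * s)" using \<open>s > 0\<close> by (intro divide_nonneg_pos) auto
  then have "s * w \<le> 1" using gap by linarith
  then have "s \<le> 1 / w" using w by (simp only: pos_le_divide_eq)
  then show "s \<le> 1 / (\<omega>\<^sup>2 / (2 * s\<^sup>2) - h)" by (simp only: w_def)
  have "s = 1 / w \<longleftrightarrow> s * w = 1"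
    using w by (simp add: eq_divide_eq)
  also have "\<dots> \<longleftrightarrow> - X / (2 * s) = 0"
    using gap by linarith
  also have "\<dots> \<longleftrightarrow> - 2 * h * X = 0"
    using \<open>s > 0\<close> h(1) by simp
  also have "\<dots> \<longleftrightarrow> s = Hill_radius \<omega> h"
    unfolding factor using upper lower(2) by auto
  finally show "s = 1 / (\<omega>\<^sup>2 / (2 * s\<^sup>2) - h) \<longleftrightarrow> s = Hill_radius \<omega> h"
    by (simp only: w_def)
qed

lemma Hill_height_on_boundary:
  assumes "\<omega>\<^sup>2 \<le> s" "s \<le> Hill_radius \<omega> h"
  shows "reduced_V \<beta> \<omega> s (Hill_height \<beta> \<omega> h s) = h"
proof -
  define R where "R = 1 / (\<omega>\<^sup>2 / (2 * s\<^sup>2) - h)"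
  have R: "s \<le> R" using Hill_boundary_gap(1)[OF assms] by (simp add: R_def)
  have "s > 0" using assms(1) \<omega> by (meson less_le_trans zero_less_power)
  then have "s\<^sup>2 \<le> R\<^sup>2" using R by (intro power_mono) auto
  then have "(1 + \<beta>) * (Hill_height \<beta> \<omega> h s)\<^sup>2 = R\<^sup>2 - s\<^sup>2"
    using \<beta> by (simp add: Hill_height_def R_def[symmetric])
  then have "reduced_V \<beta> \<omega> s (Hill_height \<beta> \<omega> h s) = \<omega>\<^sup>2 / (2 * s\<^sup>2) - 1 / R"
    using R \<open>s > 0\<close> by (simp add: reduced_V_def)
  then show ?thesis by (simp add: R_def)
qed

lemma Hill_height_pos:
  assumes "\<omega>\<^sup>2 \<le> s" "s < Hill_radius \<omega> h"
  shows "Hill_height \<beta> \<omega> h s > 0"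
proof -
  have "s > 0" using assms(1) \<omega> by (meson less_le_trans zero_less_power)
  moreover have "s < 1 / (\<omega>\<^sup>2 / (2 * s\<^sup>2) - h)"
    using Hill_boundary_gap[of s] assms by linarith
  ultimately have "s\<^sup>2 < (1 / (\<omega>\<^sup>2 / (2 * s\<^sup>2) - h))\<^sup>2"
    by (intro power_strict_mono) auto
  then show ?thesis using \<beta> by (simp add: Hill_height_def)
qed

lemma Hill_height_end: "Hill_height \<beta> \<omega> h (Hill_radius \<omega> h) = 0"
  using Hill_boundary_gap(2)[of "Hill_radius \<omega> h"] Hill_radius_greater
  unfolding Hill_height_def by simp

lemma continuous_Hill_height: "continuous_on {\<omega>\<^sup>2..} (Hill_height \<beta> \<omega> h)"
proof -
  have "s > 0" if "s \<in> {\<omega>\<^sup>2..}" for s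
    using that \<omega> by (metis atLeast_iff less_le_trans zero_less_power)
  moreover have "\<omega>\<^sup>2 / (2 * s\<^sup>2) - h > 0" for s
    by (rule inverse_Hill_dist_pos)
  ultimately show ?thesis
    unfolding Hill_height_def using \<beta>
    by (intro continuous_intros ballI) (force simp: less_imp_neq[symmetric])+
qed

end

text \<open>The shooting argument. The interval of parameters ends at a radius \<open>s2\<close> beyond the midpoint \<open>s1\<close>
of \<open>\<omega>\<^sup>2\<close> and the largest radius; this fixes the amount \<open>d\<close> by which \<open>e\<^sub>x\<close> is negative at the start
before \<open>s2\<close> is chosen so that the height \<open>y\<close> is small compared with \<open>d\<close>.\<close>
lemma perpendicular_brake_motion_exists:
  assumes \<beta>: "\<beta> > 0" and \<omega>: "\<omega> > 0" and h: "h < 0" "- (1 / (2 * \<omega>\<^sup>2)) < h"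
  shows "\<exists>r z u v T. reduced_motion \<beta> \<omega> r z u v \<and> reduced_H \<beta> \<omega> ((r 0, z 0), (u 0, v 0)) = h \<and>
    u 0 = 0 \<and> v 0 = 0 \<and> z 0 > 0 \<and> T > 0 \<and> z T = 0 \<and> u T = (0::real)"
proof -
  have \<beta>': "\<beta> > -1" using \<beta> by simp
  note hill = \<beta>' \<omega> h
  define H where "H = Hill_height \<beta> \<omega> h"
  define R where "R = Hill_radius \<omega> h"
  have R: "\<omega>\<^sup>2 < R" using Hill_radius_greater[OF hill] by (simp add: R_def)
  have H_pos: "H s > 0" if "\<omega>\<^sup>2 \<le> s" "s < R" for s
    using Hill_height_pos[OF hill] that by (simp add: H_def R_def)
  have contH: "continuous_on {\<omega>\<^sup>2..} H"
    using continuous_Hill_height[OF hill] by (simp add: H_def)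
  define s1 where "s1 = (\<omega>\<^sup>2 + R) / 2"
  have s1: "\<omega>\<^sup>2 < s1" "s1 < R" using R by (auto simp: s1_def)
  define d where "d = 1 - \<omega>\<^sup>2 / s1"
  have s1_pos: "s1 > 0" using s1(1) \<omega> by (meson less_trans zero_less_power)
  have d: "d > 0" using s1(1) s1_pos by (simp add: d_def)
  define \<phi> where "\<phi> = \<omega> * h\<^sup>2 * sqrt (2 / ((1 + \<beta>) / (\<omega>\<^sup>2 / 2) ^ 3))"
  define k where "k = sin (min \<phi> (pi / 2))"
  have "\<phi> > 0" using \<omega> h \<beta> by (simp add: \<phi>_def)
  then have k: "k > 0" unfolding k_def by (intro sin_gt_zero) (auto simp: min_def pi_gt_zero intro: less_trans)
  \<comment> \<open>A height \<open>y\<close> perturbs the eccentricity vector by at most \<open>A * y\<^sup>2\<close>.\<close>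
  define A where "A = \<omega> * (2 * (1 + \<beta>) / (\<omega>\<^sup>2 / 2) ^ 4) * (pi / (2 * (\<omega> * h\<^sup>2)))"
  have A: "A > 0" using \<omega> h \<beta> by (simp add: A_def)
  define y where "y = min (H s1) (sqrt (k * d / (2 * A)))"
  have y: "y > 0" using H_pos[of s1] s1 k d A by (simp add: y_def)
  obtain s2 where s2: "s1 \<le> s2" "s2 \<le> R" "H s2 = y"
  proof -
    have "continuous_on {s1..R} H" by (rule continuous_on_subset[OF contH]) (use s1 in auto)
    moreover have "H R = 0" using Hill_height_end[OF hill] by (simp add: H_def R_def)
    ultimately show ?thesis
      using IVT2'[of H R y s1] y s1 that by (auto simp: y_def)
  qed
  have "s2 \<noteq> R" using s2(3) y Hill_height_end[OF hill] by (auto simp: H_def R_def)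
  then have "s2 < R" using s2 by simp
  have "y\<^sup>2 \<le> (sqrt (k * d / (2 * A)))\<^sup>2" using y by (intro power_mono) (auto simp: y_def)
  then have y_small: "2 * (A * y\<^sup>2) \<le> k * d" using k d A by (simp add: field_simps)
  define S where "S = {\<omega>\<^sup>2..s2}"
  have S: "\<omega>\<^sup>2 \<le> s" "s < R" "s > 0" if "s \<in> S" for s
    using that \<open>s2 < R\<close> \<omega> by (auto simp: S_def intro: less_le_trans[of 0 "\<omega>\<^sup>2"])
  have "\<exists>r z u v :: real \<Rightarrow> real \<Rightarrow> real.
    (\<forall>s\<in>S. reduced_motion \<beta> \<omega> (r s) (z s) (u s) (v s) \<and>
       r s 0 = s \<and> z s 0 = H s \<and> u s 0 = 0 \<and> v s 0 = 0) \<and>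
    continuous_on (S \<times> UNIV) (\<lambda>(s, t). z s t) \<and> continuous_on (S \<times> UNIV) (\<lambda>(s, t). u s t)"
  proof (rule brake_motions_exist[OF \<beta>' _ h(1)])
    show "continuous_on S H" by (rule continuous_on_subset[OF contH]) (auto simp: S_def)
    show "s > 0 \<and> reduced_V \<beta> \<omega> s (H s) = h" if "s \<in> S" for s
      using S[OF that] Hill_height_on_boundary[OF hill, of s] by (simp add: H_def R_def)
  qed (use \<omega> in auto)
  then obtain r z u v :: "real \<Rightarrow> real \<Rightarrow> real"
    where motion: "\<And>s. s \<in> S \<Longrightarrow> reduced_motion \<beta> \<omega> (r s) (z s) (u s) (v s)"
      and init: "\<And>s. s \<in> S \<Longrightarrow> r s 0 = s \<and> z s 0 = H s \<and> u s 0 = 0 \<and> v s 0 = 0"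
      and cont: "continuous_on (S \<times> UNIV) (\<lambda>(s, t). z s t)" "continuous_on (S \<times> UNIV) (\<lambda>(s, t). u s t)"
    by blast
  have energy: "reduced_H \<beta> \<omega> ((r s 0, z s 0), (u s 0, v s 0)) = h" if "s \<in> S" for s
    using init[OF that] S[OF that] Hill_height_on_boundary[OF hill, of s] by (simp add: H_def R_def)
  have "\<forall>s\<in>S. \<exists>\<theta>. \<theta> 0 = 0 \<and> (\<forall>t. (\<theta> has_real_derivative \<omega> / (r s t)\<^sup>2) (at t))"
    using angle_exists[OF motion] by blast
  then obtain \<theta> where \<theta>: "\<And>s. s \<in> S \<Longrightarrow> \<theta> s 0 = 0"
    "\<And>s t. s \<in> S \<Longrightarrow> (\<theta> s has_real_derivative \<omega> / (r s t)\<^sup>2) (at t)"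
    by (metis bchoice)
  have brake: "brake_motion \<beta> \<omega> h (r s) (z s) (u s) (v s) (\<theta> s)" if "s \<in> S" for s
    using \<beta> \<omega> h motion[OF that] energy[OF that] init[OF that] \<theta>(1)[OF that] \<theta>(2)[OF that]
      H_pos[OF S(1,2)[OF that]]
    by unfold_locales auto
  have "\<forall>s\<in>S. \<exists>T. first_zero (z s) T \<and> \<theta> s T \<le> pi / 2"
    using brake_motion.first_zero_before_quarter_turn[OF brake] by blast
  then obtain T where T: "\<And>s. s \<in> S \<Longrightarrow> first_zero (z s) (T s)" "\<And>s. s \<in> S \<Longrightarrow> \<theta> s (T s) \<le> pi / 2"
    by (metis bchoice)
  have contT: "continuous_on S T"
    using continuous_first_zero[OF cont(1) T(1)] brake_motion.crosses_downward[OF brake T(1)] by blast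
  have contU: "continuous_on S (\<lambda>s. u s (T s))"
    by (rule continuous_on_compose2[OF cont(2), of S "\<lambda>s. (s, T s)", simplified])
       (use contT in \<open>auto intro: continuous_intros\<close>)
  have "\<omega>\<^sup>2 \<in> S" "s2 \<in> S" "\<omega>\<^sup>2 \<le> s2" using s1 s2 by (auto simp: S_def)
  have "u (\<omega>\<^sup>2) (T (\<omega>\<^sup>2)) \<ge> 0"
    using brake_motion.outward_if_started_inside[OF brake[OF \<open>\<omega>\<^sup>2 \<in> S\<close>], of "T (\<omega>\<^sup>2)"]
      T[OF \<open>\<omega>\<^sup>2 \<in> S\<close>] init[OF \<open>\<omega>\<^sup>2 \<in> S\<close>] by (auto simp: first_zero_def)
  moreover have "u s2 (T s2) \<le> 0"
  proof (rule brake_motion.inward_if_started_outside[OF brake[OF \<open>s2 \<in> S\<close>], of d])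
    have "\<omega>\<^sup>2 / s2 \<le> \<omega>\<^sup>2 / s1" using s2(1) s1_pos by (intro divide_left_mono) auto
    then show "\<omega>\<^sup>2 / r s2 0 - 1 \<le> - d" using init[OF \<open>s2 \<in> S\<close>] by (simp add: d_def)
    have z0: "z s2 0 = y" using init[OF \<open>s2 \<in> S\<close>] s2(3) by simp
    have A_eq: "\<omega> * (2 * (1 + \<beta>) * y\<^sup>2 / (\<omega>\<^sup>2 / 2) ^ 4) * (pi / (2 * (\<omega> * h\<^sup>2))) = A * y\<^sup>2"
      unfolding A_def by (simp only: times_divide_eq_left times_divide_eq_right mult_ac)
    show "2 * (\<omega> * (2 * (1 + \<beta>) * (z s2 0)\<^sup>2 / (\<omega>\<^sup>2 / 2) ^ 4) * (pi / (2 * (\<omega> * h\<^sup>2))))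
      \<le> sin (min (\<omega> * h\<^sup>2 * sqrt (2 / ((1 + \<beta>) / (\<omega>\<^sup>2 / 2) ^ 3))) (pi / 2)) * d"
      using y_small unfolding z0 A_eq by (simp only: k_def \<phi>_def)
  qed (use d T \<open>s2 \<in> S\<close> in auto)
  ultimately obtain s where s: "s \<in> S" "u s (T s) = 0"
    using IVT2'[of "\<lambda>s. u s (T s)" s2 0 "\<omega>\<^sup>2"] contU \<open>\<omega>\<^sup>2 \<le> s2\<close> by (auto simp: S_def)
  show ?thesis
    using motion[OF s(1)] energy[OF s(1)] init[OF s(1)] T(1)[OF s(1)] s(2)
      brake_motion.z0[OF brake[OF s(1)]]
    by (intro exI[of _ "r s"] exI[of _ "z s"] exI[of _ "u s"] exI[of _ "v s"] exI[of _ "T s"])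
       (auto simp: first_zero_def)
qed

theorem theorem5p1:
  fixes \<omega> h \<beta> :: real
  assumes "\<omega> > 0"
    and "h \<in> {- (1 / (2 * \<omega>\<^sup>2))<..<0}"
    and "\<beta> > 0"
  shows "\<exists>q p. quasi_periodic_solution \<beta> \<omega> q p \<and> \<not> planar q \<and> (\<forall>t. kepler_H \<beta> (q t, p t) = h)"
proof -
  have \<beta>: "\<beta> > -1" and h: "h < 0" "- (1 / (2 * \<omega>\<^sup>2)) < h" using assms by auto
  obtain r z u v T where motion: "reduced_motion \<beta> \<omega> r z u v"
    and energy: "reduced_H \<beta> \<omega> ((r 0, z 0), (u 0, v 0)) = h"
    and brake: "u 0 = 0" "v 0 = 0" "z 0 > 0" and T: "T > 0" "z T = 0" "u T = (0::real)"
    using perpendicular_brake_motion_exists[OF assms(3,1) h] by blast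
  obtain \<theta> where \<theta>: "\<And>t. (\<theta> has_real_derivative \<omega> / (r t)\<^sup>2) (at t)"
    using angle_exists[OF motion] by blast
  define q where "q t = (r t, \<theta> t, z t)" for t
  define p where "p t = (u t, \<omega>, v t)" for t
  have "\<omega> \<noteq> 0" using assms(1) by simp
  have "r (t + 4 * T) = r t \<and> z (t + 4 * T) = z t \<and> u (t + 4 * T) = u t \<and> v (t + 4 * T) = v t" for t
    by (rule brake_motion_periodic[OF \<beta> \<open>\<omega> \<noteq> 0\<close> _ motion brake(1,2) T(2,3)]) (use energy h in simp)
  then have "reduced_periodic_solution \<beta> \<omega> (\<lambda>t. (r t, z t)) (\<lambda>t. (u t, v t))"
    unfolding reduced_periodic_solution_def
    using reduced_motion_imp_reduced_solution[OF \<beta> motion] T(1)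
    by (intro conjI exI[of _ "4 * T"]) auto
  then have "quasi_periodic_solution \<beta> \<omega> q p"
    unfolding quasi_periodic_solution_def q_def p_def
    using reduced_motion_imp_kepler_solution[OF \<beta> motion \<theta>] by simp
  moreover have "\<not> planar q"
    using brake(3) by (auto simp: planar_def q_def intro!: exI[of _ 0])
  moreover have "kepler_H \<beta> (q t, p t) = h" for t
  proof -
    have "kepler_H \<beta> (q t, p t) = reduced_H \<beta> \<omega> ((r t, z t), (u t, v t))"
      by (simp add: q_def p_def reduced_V_def algebra_simps)
    then show ?thesis using reduced_motion_energy[OF \<beta> motion, of t] energy by simp
  qed
  ultimately show ?thesis by blast
qed

end
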